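(* Let $k$ be a field of characteristic zero, let $m\ge1$, $G=\mathbb{Z}/m\mathbb{Z}$ and $H=kG$. Let $\alpha,\beta:H\to k$ be characters and let $\pi\in G$ be an element with $\alpha(\pi)=1=\beta(\pi)$; let $m_\pi$ be the index in $G$ of the cyclic subgroup generated by $\pi$. Then $$HC_*^{\pi,\alpha,\beta}(H)=0\quad\text{if }\alpha\neq\beta,$$ $$HC_n^{\pi,\alpha,\alpha}(H)\cong\begin{cases}k\oplus\mathrm{Ann}(m_\pi)^{n/2}&\text{if } n\ge 0\text{ is even},\\ (k/m_\pi k)^{(n+1)/2}&\text{if } n\text{ is odd},\end{cases}$$ where $\mathrm{Ann}(m_\pi)=\{\lambda\in k: m_\pi\lambda=0\}$.
   Context: A character is a unital $k$-algebra map $H\to k$. $HC_*^{\pi,\alpha,\beta}(kG)$ is the cyclic homology of the cyclic $k$-module $C_n^{(\pi,\alpha,\beta)}(kG)=(kG)^{\otimes n}$ ($n\ge 0$), given on group elements by: $d_0(g_1\otimes\cdots\otimes g_n)=\alpha(g_1)g_2\otimes\cdots\otimes g_n$; $d_i(g_1\otimes\cdots\otimes g_n)=g_1\otimes\cdots\otimes g_ig_{i+1}\otimes\cdots\otimes g_n$ for $1\le i\le n-1$; $d_n(g_1\otimes\cdots\otimes g_n)=\beta(g_n)g_1\otimes\cdots\otimes g_{n-1}$ (for $n=1$: $d_0=\alpha$, $d_1=\beta$); degeneracies $s_i$ ($0\le i\le n$) inserting $1$ after $g_i$ (at the front if $i=0$); $t_n(g_1\otimes\cdots\otimes g_n)=\alpha(g_1\cdots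 g_n)\beta(g_n)\,\pi(g_1\cdots g_n)^{-1}\otimes g_1\otimes\cdots\otimes g_{n-1}$, $t_0=\mathrm{id}_k$. (This is Connes–Moscovici cyclic homology of the Hopf algebra $kG$ for the data $(\pi,\alpha,\beta)$.) The cyclic homology of a cyclic module $(C_n,d_i,s_i,t_n)$ is the homology of the total complex of the first-quadrant bicomplex whose columns are alternately $(C_*,b)$ and $(C_*,-b')$, $b=\sum_{i=0}^n(-1)^id_i$, $b'=\sum_{i=0}^{n-1}(-1)^id_i$, with horizontal maps alternately $1-\tau_n$ and $\sum_{i=0}^n\tau_n^i$, where $\tau_n=(-1)^nt_n$. *)

theory Defs
  imports "HOL-Algebra.Module" "HOL-Algebra.AbelCoset" "HOL-Algebra.Elementary_Groups" "HOL-Library.Poly_Mapping"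
begin

section \<open>Modules over a type-class field\<close>

text \<open>
  Vector spaces over the field \<open>'k\<close> are records of type \<^typ>\<open>('k, 'v) module\<close> from HOL-Algebra.
  That record type extends the ring record, so it also has multiplicative fields; they are
  \<^const>\<open>undefined\<close> where there is no multiplication.
\<close>

definition base_module :: "('k::field, 'k) module" where
  "base_module = \<lparr>carrier = UNIV, mult = (*), one = 1, zero = 0, add = (+), smult = (*)\<rparr>"

definition module_iso :: "('k, 'v) module \<Rightarrow> ('k, 'w) module \<Rightarrow> bool" (infix "\<cong>\<^sub>M" 50) where
  "M \<cong>\<^sub>M N \<longleftrightarrow>
    (\<exists>f. bij_betw f (carrier M) (carrier N) \<and>
      (\<forall>x\<in>carrier M. \<forall>y\<in>carrier M. f (x \<oplus>\<^bsub>M\<^esub> y) = f x \<oplus>\<^bsub>N\<^esub> f y) \<and>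
      (\<forall>c. \<forall>x\<in>carrier M. f (c \<odot>\<^bsub>M\<^esub> x) = c \<odot>\<^bsub>N\<^esub> f x))"

definition is_zero_module :: "('k, 'v) module \<Rightarrow> bool" where
  "is_zero_module M \<longleftrightarrow> carrier M = {\<zero>\<^bsub>M\<^esub>}"

definition submodule_on :: "('k, 'v) module \<Rightarrow> 'v set \<Rightarrow> ('k, 'v) module" where
  "submodule_on M S = M\<lparr>carrier := S\<rparr>"

definition quot_module :: "('k, 'v) module \<Rightarrow> 'v set \<Rightarrow> ('k, 'v set) module" where
  "quot_module M B =
    \<lparr>carrier = a_rcosets\<^bsub>M\<^esub> B, mult = undefined, one = undefined, zero = B,
     add = set_add M, smult = (\<lambda>c X. \<Union>x\<in>X. B +>\<^bsub>M\<^esub> (c \<odot>\<^bsub>M\<^esub> x))\<rparr>"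

definition direct_sum_module :: "('k, 'v) module \<Rightarrow> ('k, 'w) module \<Rightarrow> ('k, 'v \<times> 'w) module" where
  "direct_sum_module M N =
    \<lparr>carrier = carrier M \<times> carrier N, mult = undefined, one = undefined,
     zero = (\<zero>\<^bsub>M\<^esub>, \<zero>\<^bsub>N\<^esub>),
     add = (\<lambda>x y. (fst x \<oplus>\<^bsub>M\<^esub> fst y, snd x \<oplus>\<^bsub>N\<^esub> snd y)),
     smult = (\<lambda>c x. (c \<odot>\<^bsub>M\<^esub> fst x, c \<odot>\<^bsub>N\<^esub> snd x))\<rparr>"

definition power_module :: "('k, 'v) module \<Rightarrow> nat \<Rightarrow> ('k, nat \<Rightarrow> 'v) module" where
  "power_module M r =
    \<lparr>carrier = {..<r} \<rightarrow>\<^sub>E carrier M, mult = undefined, one = undefined,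
     zero = (\<lambda>i\<in>{..<r}. \<zero>\<^bsub>M\<^esub>),
     add = (\<lambda>x y. \<lambda>i\<in>{..<r}. x i \<oplus>\<^bsub>M\<^esub> y i),
     smult = (\<lambda>c x. \<lambda>i\<in>{..<r}. c \<odot>\<^bsub>M\<^esub> x i)\<rparr>"

definition Ann_module :: "nat \<Rightarrow> ('k::field, 'k) module" where
  "Ann_module N = submodule_on base_module {l. of_nat N * l = 0}"

definition quot_by_nat :: "nat \<Rightarrow> ('k::field, 'k set) module" where
  "quot_by_nat N = quot_module base_module {of_nat N * l |l. True}"


section \<open>Cyclic homology of a cyclic module\<close>

text \<open>
  The objects \<open>C\<^sub>n\<close> of a cyclic module are subspaces \<open>obj n\<close> of one ambient type \<open>'v\<close> with scalar
  multiplication \<open>scl\<close>; \<open>face n i\<close>, \<open>degen n i\<close> and \<open>cyc n\<close> are the operators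
  \<open>d\<^sub>i\<close>, \<open>s\<^sub>i\<close> and \<open>t\<^sub>n\<close> on \<open>C\<^sub>n\<close>. The bicomplex does not involve the degeneracies.
\<close>

record ('k, 'v) cyclic_data =
  scl :: "'k \<Rightarrow> 'v \<Rightarrow> 'v"
  obj :: "nat \<Rightarrow> 'v set"
  face :: "nat \<Rightarrow> nat \<Rightarrow> 'v \<Rightarrow> 'v"
  degen :: "nat \<Rightarrow> nat \<Rightarrow> 'v \<Rightarrow> 'v"
  cyc :: "nat \<Rightarrow> 'v \<Rightarrow> 'v"

definition hoch_b :: "('k::field, 'v::ab_group_add) cyclic_data \<Rightarrow> nat \<Rightarrow> 'v \<Rightarrow> 'v" where
  "hoch_b X n x = (\<Sum>i\<le>n. scl X ((-1) ^ i) (face X n i x))"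

definition hoch_b' :: "('k::field, 'v::ab_group_add) cyclic_data \<Rightarrow> nat \<Rightarrow> 'v \<Rightarrow> 'v" where
  "hoch_b' X n x = (\<Sum>i<n. scl X ((-1) ^ i) (face X n i x))"

definition signed_cyc :: "('k::field, 'v::ab_group_add) cyclic_data \<Rightarrow> nat \<Rightarrow> 'v \<Rightarrow> 'v" where
  "signed_cyc X n x = scl X ((-1) ^ n) (cyc X n x)"

definition cyc_norm :: "('k::field, 'v::ab_group_add) cyclic_data \<Rightarrow> nat \<Rightarrow> 'v \<Rightarrow> 'v" where
  "cyc_norm X n x = (\<Sum>i\<le>n. (signed_cyc X n ^^ i) x)"

text \<open>
  The bicomplex has \<open>C\<^sub>q\<close> in position \<open>(p, q)\<close>, where \<open>p\<close> is the column;
  \<open>vert X p q\<close> goes to \<open>(p, q - 1)\<close> and \<open>horiz X p q\<close> goes to \<open>(p - 1, q)\<close>.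
\<close>

definition vert :: "('k::field, 'v::ab_group_add) cyclic_data \<Rightarrow> nat \<Rightarrow> nat \<Rightarrow> 'v \<Rightarrow> 'v" where
  "vert X p q x = (if even p then hoch_b X q x else - hoch_b' X q x)"

definition horiz :: "('k::field, 'v::ab_group_add) cyclic_data \<Rightarrow> nat \<Rightarrow> nat \<Rightarrow> 'v \<Rightarrow> 'v" where
  "horiz X p q x = (if odd p then x - signed_cyc X q x else cyc_norm X q x)"

text \<open>
  A chain of total degree \<open>n\<close> is a family \<open>x\<close> with \<open>x p\<close> in position \<open>(p, n - p)\<close> for \<open>p \<le> n\<close>,
  padded by zero.
\<close>

definition Tot :: "('k::field, 'v::ab_group_add) cyclic_data \<Rightarrow> nat \<Rightarrow> ('k, nat \<Rightarrow> 'v) module" where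
  "Tot X n =
    \<lparr>carrier = {x. (\<forall>p\<le>n. x p \<in> obj X (n - p)) \<and> (\<forall>p>n. x p = 0)},
     mult = undefined, one = undefined,
     zero = (\<lambda>p. 0), add = (\<lambda>x y p. x p + y p), smult = (\<lambda>c x p. scl X c (x p))\<rparr>"

definition tot_diff ::
  "('k::field, 'v::ab_group_add) cyclic_data \<Rightarrow> nat \<Rightarrow> (nat \<Rightarrow> 'v) \<Rightarrow> (nat \<Rightarrow> 'v)" where
  "tot_diff X n x = (\<lambda>p. if p < n
     then vert X p (n - p) (x p) + horiz X (Suc p) (n - Suc p) (x (Suc p)) else 0)"

definition cycles :: "('k::field, 'v::ab_group_add) cyclic_data \<Rightarrow> nat \<Rightarrow> (nat \<Rightarrow> 'v) set" where
  "cycles X n = {x \<in> carrier (Tot X n). tot_diff X n x = (\<lambda>p. 0)}"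

definition boundaries :: "('k::field, 'v::ab_group_add) cyclic_data \<Rightarrow> nat \<Rightarrow> (nat \<Rightarrow> 'v) set" where
  "boundaries X n = tot_diff X (Suc n) ` carrier (Tot X (Suc n))"

definition cyclic_homology ::
  "('k::field, 'v::ab_group_add) cyclic_data \<Rightarrow> nat \<Rightarrow> ('k, (nat \<Rightarrow> 'v) set) module" where
  "cyclic_homology X n = quot_module (submodule_on (Tot X n) (cycles X n)) (boundaries X n)"


section \<open>Group algebras and characters\<close>

definition pm_scale :: "'k::field \<Rightarrow> ('a \<Rightarrow>\<^sub>0 'k) \<Rightarrow> ('a \<Rightarrow>\<^sub>0 'k)" where
  "pm_scale c = Poly_Mapping.map ((*) c)"

definition group_algebra :: "('g, 'z) monoid_scheme \<Rightarrow> ('k::field, 'g \<Rightarrow>\<^sub>0 'k) module" where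
  "group_algebra G =
    \<lparr>carrier = {x. Poly_Mapping.keys x \<subseteq> carrier G},
     mult = (\<lambda>x y. \<Sum>g\<in>Poly_Mapping.keys x. \<Sum>h\<in>Poly_Mapping.keys y.
       Poly_Mapping.single (g \<otimes>\<^bsub>G\<^esub> h) (Poly_Mapping.lookup x g * Poly_Mapping.lookup y h)),
     one = Poly_Mapping.single \<one>\<^bsub>G\<^esub> 1,
     zero = 0, add = (+), smult = pm_scale\<rparr>"

definition grp_elt :: "'g \<Rightarrow> ('g \<Rightarrow>\<^sub>0 'k::field)" where
  "grp_elt g = Poly_Mapping.single g 1"

text \<open>
  Requiring extensionality makes equality of characters in HOL the same as equality of maps
  on \<open>kG\<close>.
\<close>

definition characters :: "('g, 'z) monoid_scheme \<Rightarrow> (('g \<Rightarrow>\<^sub>0 'k::field) \<Rightarrow> 'k) set" where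
  "characters G =
    {\<chi> \<in> ring_hom (group_algebra G) base_module \<inter> extensional (carrier (group_algebra G)).
      \<forall>c. \<forall>x\<in>carrier (group_algebra G).
        \<chi> (c \<odot>\<^bsub>group_algebra G\<^esub> x) = c \<odot>\<^bsub>base_module\<^esub> \<chi> x}"


section \<open>The cyclic module of \<open>kG\<close> twisted by \<open>(\<pi>, \<alpha>, \<beta>)\<close>\<close>

text \<open>
  The tensor power \<open>(kG)\<^sup>\<otimes>\<^sup>n\<close> is the space of finitely supported functions on lists of length \<open>n\<close>
  over \<open>G\<close>: the list \<open>[g\<^sub>1, \<dots>, g\<^sub>n]\<close> is the basis tensor \<open>g\<^sub>1 \<otimes> \<dots> \<otimes> g\<^sub>n\<close>, and \<open>[]\<close> spans
  \<open>(kG)\<^sup>\<otimes>\<^sup>0 = k\<close>. The structure maps are given on basis tensors (with list positions counted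
  from 0) and extended linearly.
\<close>

definition lin_ext :: "('a \<Rightarrow> ('b \<Rightarrow>\<^sub>0 'k)) \<Rightarrow> ('a \<Rightarrow>\<^sub>0 'k::field) \<Rightarrow> ('b \<Rightarrow>\<^sub>0 'k)" where
  "lin_ext f x = (\<Sum>a\<in>Poly_Mapping.keys x. pm_scale (Poly_Mapping.lookup x a) (f a))"

definition list_mult :: "('g, 'z) monoid_scheme \<Rightarrow> 'g list \<Rightarrow> 'g" where
  "list_mult G gs = foldr (\<otimes>\<^bsub>G\<^esub>) gs \<one>\<^bsub>G\<^esub>"

definition CM_face ::
  "('g, 'z) monoid_scheme \<Rightarrow> (('g \<Rightarrow>\<^sub>0 'k::field) \<Rightarrow> 'k) \<Rightarrow> (('g \<Rightarrow>\<^sub>0 'k) \<Rightarrow> 'k) \<Rightarrow>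
    nat \<Rightarrow> nat \<Rightarrow> 'g list \<Rightarrow> ('g list \<Rightarrow>\<^sub>0 'k)" where
  "CM_face G \<alpha> \<beta> n i gs =
    (if i = 0 then Poly_Mapping.single (tl gs) (\<alpha> (grp_elt (hd gs)))
     else if i = n then Poly_Mapping.single (butlast gs) (\<beta> (grp_elt (last gs)))
     else Poly_Mapping.single
       (take (i - 1) gs @ [gs ! (i - 1) \<otimes>\<^bsub>G\<^esub> gs ! i] @ drop (i + 1) gs) 1)"

definition CM_degen ::
  "('g, 'z) monoid_scheme \<Rightarrow> nat \<Rightarrow> nat \<Rightarrow> 'g list \<Rightarrow> ('g list \<Rightarrow>\<^sub>0 'k::field)" where
  "CM_degen G n i gs = Poly_Mapping.single (take i gs @ [\<one>\<^bsub>G\<^esub>] @ drop i gs) 1"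

definition CM_cyc ::
  "('g, 'z) monoid_scheme \<Rightarrow> 'g \<Rightarrow> (('g \<Rightarrow>\<^sub>0 'k::field) \<Rightarrow> 'k) \<Rightarrow> (('g \<Rightarrow>\<^sub>0 'k) \<Rightarrow> 'k) \<Rightarrow>
    nat \<Rightarrow> 'g list \<Rightarrow> ('g list \<Rightarrow>\<^sub>0 'k)" where
  "CM_cyc G \<pi> \<alpha> \<beta> n gs =
    (if n = 0 then Poly_Mapping.single gs 1
     else Poly_Mapping.single ((\<pi> \<otimes>\<^bsub>G\<^esub> inv\<^bsub>G\<^esub> (list_mult G gs)) # butlast gs)
       (\<alpha> (grp_elt (list_mult G gs)) * \<beta> (grp_elt (last gs))))"

definition CM_module ::
  "('g, 'z) monoid_scheme \<Rightarrow> 'g \<Rightarrow> (('g \<Rightarrow>\<^sub>0 'k::field) \<Rightarrow> 'k) \<Rightarrow> (('g \<Rightarrow>\<^sub>0 'k) \<Rightarrow> 'k) \<Rightarrow>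
    ('k, 'g list \<Rightarrow>\<^sub>0 'k) cyclic_data" where
  "CM_module G \<pi> \<alpha> \<beta> =
    \<lparr>scl = pm_scale,
     obj = (\<lambda>n. {x. Poly_Mapping.keys x \<subseteq> {gs. length gs = n \<and> set gs \<subseteq> carrier G}}),
     face = (\<lambda>n i. lin_ext (CM_face G \<alpha> \<beta> n i)),
     degen = (\<lambda>n i. lin_ext (CM_degen G n i)),
     cyc = (\<lambda>n. lin_ext (CM_cyc G \<pi> \<alpha> \<beta> n))\<rparr>"

definition HC ::
  "('g, 'z) monoid_scheme \<Rightarrow> 'g \<Rightarrow> (('g \<Rightarrow>\<^sub>0 'k::field) \<Rightarrow> 'k) \<Rightarrow> (('g \<Rightarrow>\<^sub>0 'k) \<Rightarrow> 'k) \<Rightarrow>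
    nat \<Rightarrow> ('k, (nat \<Rightarrow> ('g list \<Rightarrow>\<^sub>0 'k)) set) module" where
  "HC G \<pi> \<alpha> \<beta> = cyclic_homology (CM_module G \<pi> \<alpha> \<beta>)"

definition cyclic_subgroup_index :: "('g, 'z) monoid_scheme \<Rightarrow> 'g \<Rightarrow> nat" where
  "cyclic_subgroup_index G \<pi> = card (rcosets\<^bsub>G\<^esub> (generate G {\<pi>}))"

end

theory Submission
  imports Defs "HOL.Vector_Spaces"
begin

text \<open>
  The index \<open>m\<^sub>\<pi>\<close> is a positive integer, hence invertible in a field of characteristic zero.
  So its annihilator and the quotient \<open>k / m\<^sub>\<pi> k\<close> vanish, and for \<open>\<alpha> = \<beta>\<close> the claim is that
  the cyclic homology is \<open>k\<close> in even and \<open>0\<close> in odd degrees.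

  This can be read off from the columns of the bicomplex. The columns \<open>(C, -b')\<close> are contractible
  by appending the unit of \<open>G\<close> (\<open>exact_at_odd_column\<close>). The columns \<open>(C, b)\<close> compute Tor groups
  between the one-dimensional \<open>kG\<close>-modules given by \<open>\<alpha>\<close> and \<open>\<beta>\<close>. Since the order of \<open>G\<close> is
  invertible in \<open>k\<close>, averaging over \<open>G\<close> with the weights \<open>\<alpha>(g)\<^sup>-\<^sup>1\<close> is a contraction in positive
  degrees (\<open>exact_at_even_column\<close>). In degree \<open>0\<close> there is no homology if \<open>\<alpha> \<noteq> \<beta>\<close>, by
  orthogonality of characters (\<open>exact_at_even_column_0\<close>), and there is \<open>C\<^sub>0 = k\<close> if
  \<open>\<alpha> = \<beta>\<close> (\<open>hoch_b_1_zero\<close>).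

  A staircase argument (\<open>cycle_lift\<close>) passes from the columns to the total complex. If all
  columns are exact, it gives zero; if the homology of the columns is \<open>k\<close> in row \<open>0\<close> of the even
  columns, it gives \<open>k\<close> in each even total degree, detected by the component of a cycle in row
  \<open>0\<close>. The argument needs the horizontal and vertical maps to anticommute and the horizontal maps
  to compose to zero. Both follow from three relations: \<open>d\<^sub>0 t\<^sub>n = d\<^sub>n\<close>,
  \<open>d\<^sub>i\<^sub>+\<^sub>1 t\<^sub>n = t\<^sub>n\<^sub>-\<^sub>1 d\<^sub>i\<close> and \<open>t\<^sub>n\<close> having order dividing \<open>n + 1\<close>. The third holds because
  \<open>t\<^sub>n\<close> is a weighted rotation of \<open>n + 1\<close> group elements with product \<open>\<pi>\<close> (\<open>cyc_rotate\<close>), whose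
  total weight is \<open>\<beta>(\<pi>) / \<alpha>(\<pi>) = 1\<close>.
\<close>

section \<open>The staircase argument in the cyclic bicomplex\<close>

lemma linear_funpow:
  assumes "module_hom s s f"
  shows "module_hom s s (f ^^ n)"
proof -
  interpret module_hom s s f by fact
  have "(f ^^ n) (x + y) = (f ^^ n) x + (f ^^ n) y" for x y
    by (induction n) (simp_all add: add)
  moreover have "(f ^^ n) (s c x) = s c ((f ^^ n) x)" for c x
    by (induction n) (simp_all add: scale)
  ultimately show ?thesis
    by unfold_locales
qed

text \<open>
  The part of the structure of a cyclic module that ties the faces to the cyclic operator. It
  is what makes the rows and columns fit together into a bicomplex: consecutive horizontal
  maps compose to zero, and horizontal and vertical maps anticommute.
\<close>
locale cyclic_operators = vector_space "scl X"
  for X :: "('k::field, 'v::ab_group_add) cyclic_data" +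
  assumes subspace_obj: "subspace (obj X n)"
    and linear_face: "module_hom (scl X) (scl X) (face X n i)"
    and linear_cyc: "module_hom (scl X) (scl X) (cyc X n)"
    and cyc_in_obj: "x \<in> obj X n \<Longrightarrow> cyc X n x \<in> obj X n"
    and cyc_power_Suc: "x \<in> obj X n \<Longrightarrow> (cyc X n ^^ Suc n) x = x"
    and face_0_cyc: "x \<in> obj X (Suc n) \<Longrightarrow>
      face X (Suc n) 0 (cyc X (Suc n) x) = face X (Suc n) (Suc n) x"
    and face_Suc_cyc: "i \<le> n \<Longrightarrow> x \<in> obj X (Suc n) \<Longrightarrow>
      face X (Suc n) (Suc i) (cyc X (Suc n) x) = cyc X n (face X (Suc n) i x)"
begin

abbreviation \<tau> :: "nat \<Rightarrow> 'v \<Rightarrow> 'v" where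
  "\<tau> n \<equiv> signed_cyc X n"

text \<open>
  Absorbing the signs of the alternating sums into the operators removes all signs from the
  relations: \<open>\<delta>\<^sub>0 \<tau> = \<delta>\<^sub>n\<close> and \<open>\<delta>\<^sub>i\<^sub>+\<^sub>1 \<tau> = \<tau> \<delta>\<^sub>i\<close>.
\<close>
definition \<delta> :: "nat \<Rightarrow> nat \<Rightarrow> 'v \<Rightarrow> 'v" where
  "\<delta> n i x = scl X ((- 1) ^ i) (face X n i x)"

lemma linear_\<delta>: "module_hom (scl X) (scl X) (\<delta> n i)"
  unfolding \<delta>_def
  by unfold_locales (simp_all add: module_hom.add[OF linear_face]
      module_hom.scale[OF linear_face] scale_right_distrib mult.commute)

lemma linear_\<tau>: "module_hom (scl X) (scl X) (\<tau> n)"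
  unfolding signed_cyc_def
  by unfold_locales (simp_all add: module_hom.add[OF linear_cyc]
      module_hom.scale[OF linear_cyc] scale_right_distrib mult.commute)

interpretation \<tau>: module_hom "scl X" "scl X" "\<tau> n" for n
  by (rule linear_\<tau>)

interpretation \<delta>: module_hom "scl X" "scl X" "\<delta> n i" for n i
  by (rule linear_\<delta>)

lemma \<tau>_in_obj: "x \<in> obj X n \<Longrightarrow> \<tau> n x \<in> obj X n"
  unfolding signed_cyc_def by (intro subspace_scale subspace_obj cyc_in_obj)

lemma \<tau>_power_in_obj: "x \<in> obj X n \<Longrightarrow> (\<tau> n ^^ j) x \<in> obj X n"
  by (induction j) (simp_all add: \<tau>_in_obj)

lemma hoch_b_eq: "hoch_b X n x = (\<Sum>i\<le>n. \<delta> n i x)"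
  by (simp add: hoch_b_def \<delta>_def)

lemma hoch_b'_eq: "hoch_b' X n x = (\<Sum>i<n. \<delta> n i x)"
  by (simp add: hoch_b'_def \<delta>_def)

lemma \<tau>_power_eq: "(\<tau> n ^^ j) x = scl X ((- 1) ^ (n * j)) ((cyc X n ^^ j) x)"
  by (induction j)
    (simp_all add: signed_cyc_def module_hom.scale[OF linear_cyc] power_add)

lemma \<tau>_power_Suc: "x \<in> obj X n \<Longrightarrow> (\<tau> n ^^ Suc n) x = x"
  unfolding \<tau>_power_eq using cyc_power_Suc by simp

lemma \<delta>_0_\<tau>: "x \<in> obj X (Suc n) \<Longrightarrow> \<delta> (Suc n) 0 (\<tau> (Suc n) x) = \<delta> (Suc n) (Suc n) x"
  by (simp add: \<delta>_def signed_cyc_def module_hom.scale[OF linear_face] face_0_cyc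
      del: power_Suc)

lemma \<delta>_Suc_\<tau>:
  assumes "i \<le> n" "x \<in> obj X (Suc n)"
  shows "\<delta> (Suc n) (Suc i) (\<tau> (Suc n) x) = \<tau> n (\<delta> (Suc n) i x)"
  using assms
  by (simp add: \<delta>_def signed_cyc_def module_hom.scale[OF linear_face]
      module_hom.scale[OF linear_cyc] module_hom.neg[OF linear_face] face_Suc_cyc mult.commute)

lemma \<delta>_\<tau>_power_le:
  assumes "x \<in> obj X (Suc n)" "j \<le> i" "i \<le> Suc n"
  shows "\<delta> (Suc n) i ((\<tau> (Suc n) ^^ j) x) = (\<tau> n ^^ j) (\<delta> (Suc n) (i - j) x)"
  using assms(2,3)
proof (induction j arbitrary: i)
  case (Suc j)
  then obtain i' where i: "i = Suc i'"
    by (cases i) auto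
  show ?case
    using Suc.prems Suc.IH[of i'] by (simp add: i \<delta>_Suc_\<tau> \<tau>_power_in_obj assms(1))
qed simp

text \<open>
  Moving \<open>\<delta>\<^sub>i\<close> past \<open>\<tau>\<close> lowers its index by one each time and leaves one \<open>\<tau>\<close> on the left. After
  \<open>i\<close> moves the index is \<open>0\<close>; the next \<open>\<tau>\<close> is swallowed and the index jumps to the top. This
  is why the exponent on the right is \<open>j - 1\<close>.
\<close>
lemma \<delta>_\<tau>_power_gt:
  assumes x: "x \<in> obj X (Suc n)" and ij: "i < j" "j \<le> Suc n"
  shows "\<delta> (Suc n) i ((\<tau> (Suc n) ^^ j) x)
    = (\<tau> n ^^ (j - 1)) (\<delta> (Suc n) (Suc (Suc n) + i - j) x)"
proof -
  define y where "y = (\<tau> (Suc n) ^^ (j - Suc i)) x"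
  have y: "y \<in> obj X (Suc n)"
    by (simp add: y_def \<tau>_power_in_obj x)
  have "(\<tau> (Suc n) ^^ j) x = (\<tau> (Suc n) ^^ i) (\<tau> (Suc n) y)"
  proof -
    have "j = i + Suc (j - Suc i)"
      using ij by simp
    then show ?thesis
      unfolding y_def by (metis funpow.simps(2) funpow_add o_apply)
  qed
  then have "\<delta> (Suc n) i ((\<tau> (Suc n) ^^ j) x) = (\<tau> n ^^ i) (\<delta> (Suc n) 0 (\<tau> (Suc n) y))"
    using \<delta>_\<tau>_power_le[of "\<tau> (Suc n) y" n i i] ij y by (simp add: \<tau>_in_obj)
  also have "\<dots> = (\<tau> n ^^ i) (\<delta> (Suc n) (Suc n) y)"
    by (simp add: \<delta>_0_\<tau> y)
  also have "\<dots> = (\<tau> n ^^ i) ((\<tau> n ^^ (j - Suc i)) (\<delta> (Suc n) (Suc n - (j - Suc i)) x))"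
    unfolding y_def using ij by (subst \<delta>_\<tau>_power_le[OF x]) auto
  also have "\<dots> = (\<tau> n ^^ (j - 1)) (\<delta> (Suc n) (Suc (Suc n) + i - j) x)"
  proof -
    have "j - 1 = i + (j - Suc i)" "Suc (Suc n) + i - j = Suc n - (j - Suc i)"
      using ij by auto
    then show ?thesis
      by (simp only: funpow_add o_apply)
  qed
  finally show ?thesis .
qed

lemma linear_\<tau>_power: "module_hom (scl X) (scl X) (\<tau> n ^^ a)"
  by (rule linear_funpow[OF linear_\<tau>])

lemma hoch_b_one_minus_\<tau>:
  assumes x: "x \<in> obj X (Suc n)"
  shows "hoch_b X (Suc n) (x - \<tau> (Suc n) x)
    = hoch_b' X (Suc n) x - \<tau> n (hoch_b' X (Suc n) x)"
proof -
  have "hoch_b X (Suc n) (\<tau> (Suc n) x)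
      = \<delta> (Suc n) 0 (\<tau> (Suc n) x) + (\<Sum>i\<le>n. \<delta> (Suc n) (Suc i) (\<tau> (Suc n) x))"
    unfolding hoch_b_eq by (rule sum.atMost_Suc_shift)
  also have "\<dots> = \<delta> (Suc n) (Suc n) x + \<tau> n (hoch_b' X (Suc n) x)"
    by (simp add: \<delta>_0_\<tau> \<delta>_Suc_\<tau> x hoch_b'_eq \<tau>.sum lessThan_Suc_atMost)
  finally show ?thesis
    by (simp add: hoch_b_eq hoch_b'_eq \<delta>.diff sum_subtractf lessThan_Suc_atMost
        algebra_simps)
qed

text \<open>
  Both sides expand into terms \<open>\<tau>\<^sup>a \<delta>\<^sub>l\<close>. Commuting the faces past the powers of \<open>\<tau>\<close> is a
  bijection between the pairs \<open>(i, j)\<close> indexing \<open>\<delta>\<^sub>i \<tau>\<^sup>j\<close> on the left and the pairs \<open>(a, l)\<close>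
  on the right.
\<close>
lemma hoch_b'_cyc_norm:
  assumes x: "x \<in> obj X (Suc n)"
  shows "hoch_b' X (Suc n) (cyc_norm X (Suc n) x) = cyc_norm X n (hoch_b X (Suc n) x)"
proof -
  let ?l = "\<lambda>(i, j). \<delta> (Suc n) i ((\<tau> (Suc n) ^^ j) x)"
  let ?r = "\<lambda>(a, l). (\<tau> n ^^ a) (\<delta> (Suc n) l x)"
  have "hoch_b' X (Suc n) (cyc_norm X (Suc n) x) = sum ?l ({..<Suc n} \<times> {..Suc n})"
    by (simp only: hoch_b'_eq cyc_norm_def \<delta>.sum sum.cartesian_product)
  also have "\<dots> = sum ?r ({..n} \<times> {..Suc n})"
    by (rule sum.reindex_bij_witness
        [where j = "\<lambda>(i, j). if j \<le> i then (j, i - j) else (j - 1, Suc (Suc n) + i - j)"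
          and i = "\<lambda>(a, l). if a + l \<le> n then (a + l, a) else (a + l - Suc n, Suc a)"])
      (auto simp: \<delta>_\<tau>_power_le[OF x] \<delta>_\<tau>_power_gt[OF x] split: if_splits)
  also have "\<dots> = cyc_norm X n (hoch_b X (Suc n) x)"
    by (simp only: hoch_b_eq cyc_norm_def module_hom.sum[OF linear_\<tau>_power] sum.cartesian_product)
  finally show ?thesis .
qed

lemma \<tau>_cyc_norm: "x \<in> obj X n \<Longrightarrow> \<tau> n (cyc_norm X n x) = cyc_norm X n x"
proof -
  assume x: "x \<in> obj X n"
  have "\<tau> n (cyc_norm X n x) = (\<Sum>i\<le>n. (\<tau> n ^^ Suc i) x)"
    by (simp add: cyc_norm_def \<tau>.sum)
  also have "x + \<dots> = cyc_norm X n x + (\<tau> n ^^ Suc n) x"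
    unfolding cyc_norm_def
    using sum.atMost_Suc_shift[of "\<lambda>i. (\<tau> n ^^ i) x" n]
    by (simp only: sum.atMost_Suc funpow_0)
  finally show ?thesis
    by (simp only: \<tau>_power_Suc[OF x]) simp
qed

lemma cyc_norm_\<tau>: "x \<in> obj X n \<Longrightarrow> cyc_norm X n (\<tau> n x) = cyc_norm X n x"
  using \<tau>_cyc_norm[of x n]
  by (simp add: cyc_norm_def \<tau>.sum funpow_swap1)

lemma linear_hoch_b: "module_hom (scl X) (scl X) (hoch_b X n)"
  unfolding hoch_b_eq
  by unfold_locales (simp_all add: \<delta>.add \<delta>.scale sum.distrib scale_sum_right)

lemma linear_hoch_b': "module_hom (scl X) (scl X) (hoch_b' X n)"
  unfolding hoch_b'_eq
  by unfold_locales (simp_all add: \<delta>.add \<delta>.scale sum.distrib scale_sum_right)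

lemma linear_cyc_norm: "module_hom (scl X) (scl X) (cyc_norm X n)"
  unfolding cyc_norm_def
  by unfold_locales (simp_all add: module_hom.add[OF linear_\<tau>_power] module_hom.scale[OF linear_\<tau>_power]
      sum.distrib scale_sum_right)

lemma linear_vert: "module_hom (scl X) (scl X) (vert X p q)"
  unfolding vert_def
  by unfold_locales
    (auto simp: module_hom.add[OF linear_hoch_b] module_hom.add[OF linear_hoch_b']
      module_hom.scale[OF linear_hoch_b] module_hom.scale[OF linear_hoch_b'])

lemma linear_horiz: "module_hom (scl X) (scl X) (horiz X p q)"
  unfolding horiz_def
  by unfold_locales
    (auto simp: module_hom.add[OF linear_cyc_norm] module_hom.scale[OF linear_cyc_norm]
      \<tau>.add \<tau>.scale scale_right_diff_distrib)

lemma horiz_in_obj: "x \<in> obj X q \<Longrightarrow> horiz X p q x \<in> obj X q"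
  unfolding horiz_def cyc_norm_def
  by (auto intro!: subspace_diff subspace_sum subspace_obj \<tau>_in_obj \<tau>_power_in_obj)

lemma horiz_horiz: "x \<in> obj X q \<Longrightarrow> horiz X p q (horiz X (Suc p) q x) = 0"
  by (simp add: horiz_def \<tau>_cyc_norm cyc_norm_\<tau>
      module_hom.diff[OF linear_cyc_norm])

lemma vert_horiz:
  assumes "x \<in> obj X (Suc q)"
  shows "vert X p (Suc q) (horiz X (Suc p) (Suc q) x)
    = - horiz X (Suc p) q (vert X (Suc p) (Suc q) x)"
  using hoch_b_one_minus_\<tau>[OF assms] hoch_b'_cyc_norm[OF assms]
  by (simp add: vert_def horiz_def \<tau>.neg)

text \<open>
  In row \<open>0\<close> every element is a vertical cycle, since \<open>vert\<close> has no target there. The value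
  that \<open>vert X p 0\<close> happens to have is therefore disregarded.
\<close>
definition exact_at :: "nat \<Rightarrow> nat \<Rightarrow> bool" where
  "exact_at p q \<longleftrightarrow> (\<forall>z \<in> obj X q. (q = 0 \<or> vert X p q z = 0) \<longrightarrow>
    (\<exists>y \<in> obj X (Suc q). vert X p (Suc q) y = z))"

text \<open>
  The staircase argument. To solve \<open>D y = x\<close> for a cycle \<open>x\<close>, the components \<open>y\<^sub>p\<close> are found
  in order of decreasing column \<open>p\<close>: the equation for \<open>y\<^sub>p\<close> asks for a vertical preimage of
  \<open>x\<^sub>p\<close> minus the horizontal image of \<open>y\<^sub>p\<^sub>+\<^sub>1\<close>. That difference is a vertical cycle because
  \<open>x\<close> is a cycle and the bicomplex relations hold, so exactness of column \<open>p\<close> provides \<open>y\<^sub>p\<close>.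
  The component \<open>u\<close> in row \<open>0\<close> of the last column is prescribed. With \<open>u = 0\<close> the lemma shows
  that cycles are boundaries; with \<open>x = 0\<close> and \<open>u\<close> arbitrary it extends \<open>u\<close> to a cycle.
\<close>
lemma cycle_lift:
  assumes exact: "\<And>p. p < n \<Longrightarrow> exact_at p (n - p)"
    and x: "x \<in> cycles X n"
    and u: "u \<in> obj X 0" and v: "v \<in> obj X 1"
    and top: "vert X n 1 v + horiz X (Suc n) 0 u = x n"
  obtains y where "y \<in> carrier (Tot X (Suc n))" "tot_diff X (Suc n) y = x" "y (Suc n) = u"
proof -
  have x_obj: "x p \<in> obj X (n - p)" if "p \<le> n" for p
    using x that by (simp add: cycles_def Tot_def)
  have x_0: "x p = 0" if "p > n" for p
    using x that by (simp add: cycles_def Tot_def)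
  have x_cycle: "vert X p (n - p) (x p) + horiz X (Suc p) (n - Suc p) (x (Suc p)) = 0"
    if "p < n" for p
  proof -
    have "tot_diff X n x p = 0"
      using x by (simp add: cycles_def)
    then show ?thesis
      using that by (simp add: tot_diff_def)
  qed
  let ?P = "\<lambda>k y. y \<in> carrier (Tot X (Suc n)) \<and> y (Suc n) = u \<and>
    (\<forall>p. k \<le> p \<and> p \<le> n \<longrightarrow>
      vert X p (Suc n - p) (y p) + horiz X (Suc p) (n - p) (y (Suc p)) = x p)"
  have "\<exists>y. ?P 0 y"
  proof (rule inc_induct[of 0 n "\<lambda>k. \<exists>y. ?P k y"])
    let ?y = "(\<lambda>p. 0)(n := v, Suc n := u)"
    have "Suc n - p = 0 \<longleftrightarrow> p = Suc n" if "p \<le> Suc n" for p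
      using that by auto
    then have "?P n ?y"
      using u v top by (auto simp: Tot_def subspace_0[OF subspace_obj])
    then show "\<exists>y. ?P n y"
      by (rule exI[of _ ?y])
  next
    fix k assume "k < n" and "\<exists>y. ?P (Suc k) y"
    then obtain y where y: "y \<in> carrier (Tot X (Suc n))" "y (Suc n) = u"
      and eq: "\<And>p. Suc k \<le> p \<Longrightarrow> p \<le> n \<Longrightarrow>
        vert X p (Suc n - p) (y p) + horiz X (Suc p) (n - p) (y (Suc p)) = x p"
      by blast
    have y_obj: "y p \<in> obj X (Suc n - p)" if "p \<le> Suc n" for p
      using y(1) that by (simp add: Tot_def)
    define q where "q = n - Suc k"
    have q: "n - k = Suc q" "Suc n - k = Suc (Suc q)" "n - Suc k = q"
      using \<open>k < n\<close> by (auto simp: q_def)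
    have yk: "y (Suc k) \<in> obj X (Suc q)" and yk': "y (Suc (Suc k)) \<in> obj X q"
      using y_obj[of "Suc k"] y_obj[of "Suc (Suc k)"] q \<open>k < n\<close> by simp_all
    \<comment> \<open>The equation in column \<open>k\<close> asks for a vertical preimage of \<open>z\<close>.\<close>
    define z where "z = x k - horiz X (Suc k) (Suc q) (y (Suc k))"
    have z: "z \<in> obj X (Suc q)"
      unfolding z_def using x_obj[of k] \<open>k < n\<close> q
      by (intro subspace_diff subspace_obj horiz_in_obj yk) auto
    have "vert X (Suc k) (Suc q) (y (Suc k))
        = x (Suc k) - horiz X (Suc (Suc k)) q (y (Suc (Suc k)))"
      using eq[of "Suc k"] \<open>k < n\<close> q by (simp add: eq_diff_eq)
    then have "horiz X (Suc k) q (vert X (Suc k) (Suc q) (y (Suc k)))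
        = horiz X (Suc k) q (x (Suc k))"
      by (simp add: module_hom.diff[OF linear_horiz] horiz_horiz yk')
    then have "vert X k (Suc q) z = 0"
      using x_cycle[of k] \<open>k < n\<close> q
      by (simp add: z_def module_hom.diff[OF linear_vert] vert_horiz[OF yk])
    then obtain w where w: "w \<in> obj X (Suc (Suc q))" "vert X k (Suc (Suc q)) w = z"
      using exact[OF \<open>k < n\<close>] z q by (auto simp: exact_at_def)
    have "?P k (y(k := w))"
    proof (intro conjI allI impI)
      show "y(k := w) \<in> carrier (Tot X (Suc n))"
        using y(1) w(1) q \<open>k < n\<close> by (auto simp: Tot_def)
      show "(y(k := w)) (Suc n) = u"
        using y(2) \<open>k < n\<close> by simp
      fix p assume "k \<le> p \<and> p \<le> n"
      then show "vert X p (Suc n - p) ((y(k := w)) p)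
          + horiz X (Suc p) (n - p) ((y(k := w)) (Suc p)) = x p"
        using eq[of p] w(2) q by (cases "p = k") (auto simp: z_def)
    qed
    then show "\<exists>y. ?P k y"
      by (rule exI[of _ "y(k := w)"])
  qed simp
  then obtain y where y: "y \<in> carrier (Tot X (Suc n))" "y (Suc n) = u"
    and eq: "\<And>p. p \<le> n \<Longrightarrow>
      vert X p (Suc n - p) (y p) + horiz X (Suc p) (n - p) (y (Suc p)) = x p"
    by auto
  have "tot_diff X (Suc n) y = x"
    using eq x_0 by (auto simp: tot_diff_def fun_eq_iff)
  with y show thesis
    by (intro that)
qed

end

section \<open>The coefficient modules when the index is invertible\<close>

lemma module_iso_trans:
  assumes "M \<cong>\<^sub>M N" "N \<cong>\<^sub>M P"
  shows "M \<cong>\<^sub>M P"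
proof -
  obtain f where f: "bij_betw f (carrier M) (carrier N)"
    "\<And>x y. x \<in> carrier M \<Longrightarrow> y \<in> carrier M \<Longrightarrow> f (x \<oplus>\<^bsub>M\<^esub> y) = f x \<oplus>\<^bsub>N\<^esub> f y"
    "\<And>c x. x \<in> carrier M \<Longrightarrow> f (c \<odot>\<^bsub>M\<^esub> x) = c \<odot>\<^bsub>N\<^esub> f x"
    using assms(1) unfolding module_iso_def by auto
  obtain g where g: "bij_betw g (carrier N) (carrier P)"
    "\<And>x y. x \<in> carrier N \<Longrightarrow> y \<in> carrier N \<Longrightarrow> g (x \<oplus>\<^bsub>N\<^esub> y) = g x \<oplus>\<^bsub>P\<^esub> g y"
    "\<And>c x. x \<in> carrier N \<Longrightarrow> g (c \<odot>\<^bsub>N\<^esub> x) = c \<odot>\<^bsub>P\<^esub> g x"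
    using assms(2) unfolding module_iso_def by auto
  have "f x \<in> carrier N" if "x \<in> carrier M" for x
    using f(1) that by (auto simp: bij_betw_def)
  then show ?thesis
    unfolding module_iso_def using bij_betw_trans[OF f(1) g(1)]
    by (intro exI[of _ "g \<circ> f"]) (auto simp: f g)
qed

lemma zero_module_iso:
  assumes "is_zero_module M" "is_zero_module N"
    and "\<zero>\<^bsub>N\<^esub> \<oplus>\<^bsub>N\<^esub> \<zero>\<^bsub>N\<^esub> = \<zero>\<^bsub>N\<^esub>" "\<And>c. c \<odot>\<^bsub>N\<^esub> \<zero>\<^bsub>N\<^esub> = \<zero>\<^bsub>N\<^esub>"
  shows "M \<cong>\<^sub>M N"
  unfolding module_iso_def using assms
  by (intro exI[of _ "\<lambda>_. \<zero>\<^bsub>N\<^esub>"]) (auto simp: is_zero_module_def bij_betw_def)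

lemma is_zero_power_module:
  assumes "is_zero_module M"
  shows "is_zero_module (power_module M r)"
  using assms PiE_singleton[of "\<lambda>i\<in>{..<r}. \<zero>\<^bsub>M\<^esub>" "{..<r}"]
  by (simp add: is_zero_module_def power_module_def cong: PiE_cong)

lemma is_zero_Ann_module:
  assumes "of_nat N \<noteq> (0 :: 'k::field)"
  shows "is_zero_module (Ann_module N :: ('k, 'k) module)"
  using assms by (auto simp: is_zero_module_def Ann_module_def submodule_on_def base_module_def)

lemma range_mult_of_nat:
  assumes "of_nat N \<noteq> (0 :: 'k::field)"
  shows "{of_nat N * l |l. True} = (UNIV :: 'k set)"
proof -
  have "y = of_nat N * (y / of_nat N)" for y :: 'k
    using assms by simp
  then show ?thesis
    by blast
qed

lemma is_zero_quot_by_nat: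
  assumes "of_nat N \<noteq> (0 :: 'k::field)"
  shows "is_zero_module (quot_by_nat N :: ('k, 'k set) module)"
proof -
  have "UNIV +>\<^bsub>base_module\<^esub> a = UNIV" for a :: 'k
    by (auto simp: a_r_coset_def' base_module_def) (metis diff_add_cancel)
  then show ?thesis
    unfolding is_zero_module_def quot_by_nat_def range_mult_of_nat[OF assms]
    by (simp add: quot_module_def A_RCOSETS_def') (simp add: base_module_def)
qed

lemma zero_module_iso_power_quot_by_nat:
  assumes "of_nat N \<noteq> (0 :: 'k::field)" "is_zero_module M"
  shows "M \<cong>\<^sub>M power_module (quot_by_nat N :: ('k, 'k set) module) r"
proof (rule zero_module_iso[OF assms(2)])
  show "is_zero_module (power_module (quot_by_nat N :: ('k, 'k set) module) r)"
    by (intro is_zero_power_module is_zero_quot_by_nat assms)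
  have [simp]: "UNIV <+>\<^bsub>base_module\<^esub> UNIV = (UNIV :: 'k set)"
    by (auto simp: set_add_def' base_module_def)
  have [simp]: "(\<Union>x. UNIV +>\<^bsub>base_module\<^esub> f x) = (UNIV :: 'k set)" for f :: "'k \<Rightarrow> 'k"
    by (auto simp: a_r_coset_def' base_module_def) (metis diff_add_cancel)
  let ?P = "power_module (quot_by_nat N :: ('k, 'k set) module) r"
  show "\<zero>\<^bsub>?P\<^esub> \<oplus>\<^bsub>?P\<^esub> \<zero>\<^bsub>?P\<^esub> = \<zero>\<^bsub>?P\<^esub>" "c \<odot>\<^bsub>?P\<^esub> \<zero>\<^bsub>?P\<^esub> = \<zero>\<^bsub>?P\<^esub>" for c
    unfolding quot_by_nat_def range_mult_of_nat[OF assms(1)]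
    by (simp_all add: power_module_def quot_module_def fun_eq_iff)
qed

lemma base_module_iso_direct_sum_Ann:
  assumes "of_nat N \<noteq> (0 :: 'k::field)"
  shows "(base_module :: ('k, 'k) module) \<cong>\<^sub>M
    direct_sum_module base_module (power_module (Ann_module N) r)"
proof -
  let ?z = "\<lambda>i\<in>{..<r}. 0 :: 'k"
  have "carrier (power_module (Ann_module N :: ('k, 'k) module) r) = {?z}"
    using is_zero_power_module[OF is_zero_Ann_module[OF assms], of r]
    by (simp add: is_zero_module_def power_module_def Ann_module_def submodule_on_def
        base_module_def)
  then show ?thesis
    unfolding module_iso_def
    by (intro exI[of _ "\<lambda>c. (c, ?z)"])
      (auto simp: bij_betw_def inj_on_def direct_sum_module_def base_module_def
        power_module_def Ann_module_def submodule_on_def fun_eq_iff)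
qed

section \<open>Cyclic homology from the homology of the columns\<close>

context cyclic_operators
begin

definition coset :: "nat \<Rightarrow> (nat \<Rightarrow> 'v) \<Rightarrow> (nat \<Rightarrow> 'v) set" where
  "coset n z = (\<lambda>b p. b p + z p) ` boundaries X n"

lemma tot_diff_add:
  "tot_diff X n (\<lambda>p. x p + y p) = (\<lambda>p. tot_diff X n x p + tot_diff X n y p)"
  by (simp add: fun_eq_iff tot_diff_def module_hom.add[OF linear_vert]
      module_hom.add[OF linear_horiz])

lemma tot_diff_scale:
  "tot_diff X n (\<lambda>p. scl X c (x p)) = (\<lambda>p. scl X c (tot_diff X n x p))"
  by (simp add: fun_eq_iff tot_diff_def module_hom.scale[OF linear_vert]
      module_hom.scale[OF linear_horiz] scale_right_distrib)

lemma Tot_add: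
  "x \<in> carrier (Tot X n) \<Longrightarrow> y \<in> carrier (Tot X n) \<Longrightarrow> (\<lambda>p. x p + y p) \<in> carrier (Tot X n)"
  by (simp add: Tot_def subspace_add[OF subspace_obj])

lemma Tot_scale:
  "x \<in> carrier (Tot X n) \<Longrightarrow> (\<lambda>p. scl X c (x p)) \<in> carrier (Tot X n)"
  by (simp add: Tot_def subspace_scale[OF subspace_obj])

lemma cycles_add:
  "x \<in> cycles X n \<Longrightarrow> y \<in> cycles X n \<Longrightarrow> (\<lambda>p. x p + y p) \<in> cycles X n"
  by (simp add: cycles_def Tot_add tot_diff_add)

lemma cycles_scale: "x \<in> cycles X n \<Longrightarrow> (\<lambda>p. scl X c (x p)) \<in> cycles X n"
  by (simp add: cycles_def Tot_scale tot_diff_scale)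

lemma cycles_diff:
  "x \<in> cycles X n \<Longrightarrow> y \<in> cycles X n \<Longrightarrow> (\<lambda>p. x p - y p) \<in> cycles X n"
  using cycles_add[OF _ cycles_scale[of y n "-1"], of x] by simp

lemma boundaries_add:
  assumes "x \<in> boundaries X n" "y \<in> boundaries X n"
  shows "(\<lambda>p. x p + y p) \<in> boundaries X n"
  using assms unfolding boundaries_def
  by (auto simp: tot_diff_add[symmetric] intro!: imageI Tot_add)

lemma boundaries_scale:
  assumes "x \<in> boundaries X n"
  shows "(\<lambda>p. scl X c (x p)) \<in> boundaries X n"
  using assms unfolding boundaries_def
  by (auto simp: tot_diff_scale[symmetric] intro!: imageI Tot_scale)

lemma boundaries_0: "(\<lambda>p. 0) \<in> boundaries X n"
proof -
  have z: "(\<lambda>p. 0) \<in> carrier (Tot X (Suc n))"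
    by (simp add: Tot_def subspace_0[OF subspace_obj])
  have "tot_diff X (Suc n) (\<lambda>p. 0) \<in> boundaries X n"
    unfolding boundaries_def by (rule imageI[OF z])
  from boundaries_scale[OF this, of 0] show ?thesis
    by simp
qed

lemma boundaries_diff:
  "x \<in> boundaries X n \<Longrightarrow> y \<in> boundaries X n \<Longrightarrow> (\<lambda>p. x p - y p) \<in> boundaries X n"
  using boundaries_add[OF _ boundaries_scale[of y n "-1"], of x] by simp

lemma coset_iff: "w \<in> coset n z \<longleftrightarrow> (\<lambda>p. w p - z p) \<in> boundaries X n"
proof
  assume "(\<lambda>p. w p - z p) \<in> boundaries X n"
  then have "(\<lambda>p. (w p - z p) + z p) \<in> coset n z"
    unfolding coset_def by (rule imageI[where f = "\<lambda>b p. b p + z p"])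
  then show "w \<in> coset n z"
    by simp
qed (auto simp: coset_def)

lemma self_in_coset: "z \<in> coset n z"
  by (simp add: coset_iff boundaries_0)

lemma coset_cong: "w \<in> coset n z \<Longrightarrow> coset n w = coset n z"
proof -
  assume *: "w \<in> coset n z"
  have "v \<in> coset n w \<longleftrightarrow> v \<in> coset n z" for v
    using boundaries_add[OF _ *[unfolded coset_iff], of "\<lambda>p. v p - w p"]
      boundaries_diff[OF _ *[unfolded coset_iff], of "\<lambda>p. v p - z p"]
    by (auto simp: coset_iff)
  then show ?thesis
    by blast
qed

lemma coset_boundary: "z \<in> boundaries X n \<Longrightarrow> coset n z = boundaries X n"
  using coset_cong[of z n "\<lambda>p. 0"] by (simp add: coset_iff coset_def)

lemma carrier_cyclic_homology: "carrier (cyclic_homology X n) = coset n ` cycles X n"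
  by (auto simp: cyclic_homology_def quot_module_def A_RCOSETS_def' a_r_coset_def'
      submodule_on_def Tot_def coset_def image_def)

lemma zero_cyclic_homology: "\<zero>\<^bsub>cyclic_homology X n\<^esub> = boundaries X n"
  by (simp add: cyclic_homology_def quot_module_def)

lemma add_cyclic_homology:
  "coset n z \<oplus>\<^bsub>cyclic_homology X n\<^esub> coset n w = coset n (\<lambda>p. z p + w p)"
proof -
  have "coset n z \<oplus>\<^bsub>cyclic_homology X n\<^esub> coset n w
      = (\<Union>x\<in>coset n z. \<Union>y\<in>coset n w. {\<lambda>p. x p + y p})"
    by (simp add: cyclic_homology_def quot_module_def set_add_def' submodule_on_def Tot_def)
  also have "\<dots> = coset n (\<lambda>p. z p + w p)"
  proof (intro equalityI subsetI)
    fix v assume "v \<in> (\<Union>x\<in>coset n z. \<Union>y\<in>coset n w. {\<lambda>p. x p + y p})"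
    then obtain x y where "x \<in> coset n z" "y \<in> coset n w" "v = (\<lambda>p. x p + y p)"
      by blast
    then show "v \<in> coset n (\<lambda>p. z p + w p)"
      using boundaries_add[of "\<lambda>p. x p - z p" n "\<lambda>p. y p - w p"]
      by (simp add: coset_iff algebra_simps)
  next
    fix v assume "v \<in> coset n (\<lambda>p. z p + w p)"
    then have "(\<lambda>p. v p - w p) \<in> coset n z"
      by (simp add: coset_iff algebra_simps)
    moreover have "v = (\<lambda>p. (v p - w p) + w p)"
      by simp
    ultimately show "v \<in> (\<Union>x\<in>coset n z. \<Union>y\<in>coset n w. {\<lambda>p. x p + y p})"
      using self_in_coset[of w n] by blast
  qed
  finally show ?thesis .
qed

lemma smult_cyclic_homology:
  "c \<odot>\<^bsub>cyclic_homology X n\<^esub> coset n z = coset n (\<lambda>p. scl X c (z p))"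
proof -
  have "c \<odot>\<^bsub>cyclic_homology X n\<^esub> coset n z = (\<Union>x\<in>coset n z. coset n (\<lambda>p. scl X c (x p)))"
    by (auto simp: cyclic_homology_def quot_module_def submodule_on_def Tot_def
        a_r_coset_def' coset_def)
  also have "\<dots> = (\<Union>x\<in>coset n z. coset n (\<lambda>p. scl X c (z p)))"
  proof (rule SUP_cong[OF refl])
    fix x assume "x \<in> coset n z"
    then show "coset n (\<lambda>p. scl X c (x p)) = coset n (\<lambda>p. scl X c (z p))"
      using boundaries_scale[of "\<lambda>p. x p - z p" n c]
      by (intro coset_cong) (simp add: coset_iff scale_right_diff_distrib)
  qed
  also have "\<dots> = coset n (\<lambda>p. scl X c (z p))"
    using self_in_coset[of z n] by blast
  finally show ?thesis .
qed

lemma cyclic_homology_zero: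
  assumes exact: "\<And>p. p \<le> n \<Longrightarrow> exact_at p (n - p)"
  shows "is_zero_module (cyclic_homology X n)"
proof -
  have "x \<in> boundaries X n" if x: "x \<in> cycles X n" for x
  proof -
    have "x n \<in> obj X 0"
      using x by (auto simp: cycles_def Tot_def)
    then obtain v where v: "v \<in> obj X 1" "vert X n 1 v = x n"
      using exact[of n] by (auto simp: exact_at_def)
    have "vert X n 1 v + horiz X (Suc n) 0 0 = x n"
      using v module_hom.zero[OF linear_horiz] by simp
    then obtain y where "y \<in> carrier (Tot X (Suc n))" "tot_diff X (Suc n) y = x"
      using cycle_lift[OF exact x subspace_0[OF subspace_obj] v(1)] by auto
    then show ?thesis
      by (auto simp: boundaries_def)
  qed
  moreover have "(\<lambda>p. 0) \<in> cycles X n"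
    by (auto simp: cycles_def Tot_def subspace_0[OF subspace_obj] tot_diff_def fun_eq_iff
        module_hom.zero[OF linear_vert] module_hom.zero[OF linear_horiz])
  ultimately show ?thesis
    by (auto simp: is_zero_module_def carrier_cyclic_homology zero_cyclic_homology
        coset_boundary)
qed

text \<open>
  If the only homology of the columns is a line in row \<open>0\<close> of the even columns, then for even
  \<open>n\<close> the total homology is detected by the component \<open>x\<^sub>n\<close> in row \<open>0\<close>. Boundaries have
  \<open>x\<^sub>n = 0\<close>, because \<open>b\<close> vanishes on \<open>C\<^sub>1\<close> and \<open>1 - \<tau>\<^sub>0\<close> vanishes on \<open>C\<^sub>0\<close>. Conversely, a
  cycle with \<open>x\<^sub>n = 0\<close> is a boundary, and every element of \<open>C\<^sub>0\<close> is the component of a cycle,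
  by the staircase argument in degrees \<open>n\<close> and \<open>n - 1\<close>.
\<close>
lemma cyclic_homology_one_dimensional:
  assumes exact: "\<And>p q. odd p \<or> q \<noteq> 0 \<Longrightarrow> exact_at p q"
    and b_0: "\<And>v. v \<in> obj X 1 \<Longrightarrow> hoch_b X 1 v = 0"
    and \<epsilon>: "module_hom (scl X) (*) \<epsilon>" "bij_betw \<epsilon> (obj X 0) (UNIV :: 'k set)"
    and n: "even n"
  shows "cyclic_homology X n \<cong>\<^sub>M (base_module :: ('k, 'k) module)"
proof -
  have top_obj: "x n \<in> obj X 0" if "x \<in> cycles X n" for x
    using that by (auto simp: cycles_def Tot_def)
  have top_boundary: "x n = 0" if x: "x \<in> boundaries X n" for x
  proof -
    obtain y where y: "y \<in> carrier (Tot X (Suc n))" "x = tot_diff X (Suc n) y"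
      using x by (auto simp: boundaries_def)
    have "\<forall>p\<le>Suc n. y p \<in> obj X (Suc n - p)"
      using y(1) by (simp add: Tot_def)
    from this[rule_format, of n] this[rule_format, of "Suc n"]
    have "y n \<in> obj X 1" "y (Suc n) \<in> obj X 0"
      by simp_all
    then show ?thesis
      using n \<tau>_power_Suc[of "y (Suc n)" 0] b_0
      by (simp add: y(2) tot_diff_def vert_def horiz_def)
  qed
  have boundary: "x \<in> boundaries X n" if x: "x \<in> cycles X n" and "x n = 0" for x
  proof -
    have "vert X n 1 0 + horiz X (Suc n) 0 0 = x n"
      using \<open>x n = 0\<close> module_hom.zero[OF linear_horiz] module_hom.zero[OF linear_vert] by simp
    moreover have "exact_at p (n - p)" if "p < n" for p
      using exact that by simp
    ultimately obtain y where "y \<in> carrier (Tot X (Suc n))" "tot_diff X (Suc n) y = x"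
      using cycle_lift[of n x 0 0] x subspace_0[OF subspace_obj] by auto
    then show ?thesis
      by (auto simp: boundaries_def)
  qed
  \<comment> \<open>The column next to the last one is odd, so it is exact in row \<open>0\<close> as well and the staircase
    can start from \<open>u\<close>.\<close>
  have surj: "\<exists>x \<in> cycles X n. x n = u" if u: "u \<in> obj X 0" for u
  proof (cases n)
    case 0
    then show ?thesis
      using u by (intro bexI[of _ "(\<lambda>p. 0)(0 := u)"])
        (auto simp: cycles_def Tot_def tot_diff_def)
  next
    case (Suc m)
    have odd: "odd m"
      using n Suc by simp
    have 0: "(\<lambda>p. 0) \<in> cycles X m"
      by (auto simp: cycles_def Tot_def subspace_0[OF subspace_obj] tot_diff_def fun_eq_iff
          module_hom.zero[OF linear_vert] module_hom.zero[OF linear_horiz])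
    have "- horiz X n 0 u \<in> obj X 0"
      by (intro subspace_neg subspace_obj horiz_in_obj u)
    then obtain v where v: "v \<in> obj X 1" "vert X m 1 v = - horiz X n 0 u"
      using exact[of m 0] odd by (auto simp: exact_at_def)
    have ex: "exact_at p (m - p)" if "p < m" for p
      using exact that by simp
    have "vert X m 1 v + horiz X (Suc m) 0 u = 0"
      using v(2) Suc by simp
    then obtain y where "y \<in> carrier (Tot X (Suc m))" "tot_diff X (Suc m) y = (\<lambda>p. 0)"
      "y (Suc m) = u"
      using cycle_lift[OF ex 0 u v(1)] by blast
    then show ?thesis
      using Suc by (auto simp: cycles_def)
  qed
  \<comment> \<open>The component in row \<open>0\<close> is constant on a coset, so any representative may be chosen.\<close>
  define \<phi> where "\<phi> S = \<epsilon> ((SOME x. x \<in> S) n)" for S :: "(nat \<Rightarrow> 'v) set"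
  have \<phi>: "\<phi> (coset n z) = \<epsilon> (z n)" for z
  proof -
    define w where "w = (SOME x. x \<in> coset n z)"
    have "w \<in> coset n z"
      unfolding w_def by (rule someI[of "\<lambda>x. x \<in> coset n z", OF self_in_coset])
    from top_boundary[OF this[unfolded coset_iff]] have "w n = z n"
      by simp
    then show ?thesis
      by (simp only: \<phi>_def w_def)
  qed
  have "bij_betw \<phi> (carrier (cyclic_homology X n)) UNIV"
  proof (rule bij_betwI')
    fix S T assume "S \<in> carrier (cyclic_homology X n)" "T \<in> carrier (cyclic_homology X n)"
    then obtain z w where z: "z \<in> cycles X n" "S = coset n z" and w: "w \<in> cycles X n" "T = coset n w"
      by (auto simp: carrier_cyclic_homology)
    have "S = T" if "\<phi> S = \<phi> T"
    proof -
      have "z n = w n"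
        using that \<epsilon>(2) top_obj z(1) w(1) by (auto simp: z(2) w(2) \<phi> bij_betw_def inj_on_def)
      then have "z \<in> coset n w"
        using boundary[OF cycles_diff[OF z(1) w(1)]] by (simp add: coset_iff)
      then show ?thesis
        using z(2) w(2) coset_cong by simp
    qed
    then show "\<phi> S = \<phi> T \<longleftrightarrow> S = T"
      by blast
  next
    fix c :: 'k
    obtain u where u: "u \<in> obj X 0" "c = \<epsilon> u"
      using \<epsilon>(2) by (metis UNIV_I bij_betw_def imageE)
    then show "\<exists>S \<in> carrier (cyclic_homology X n). c = \<phi> S"
      using surj[OF u(1)] by (force simp: carrier_cyclic_homology \<phi>)
  qed simp
  then show ?thesis
    unfolding module_iso_def
    by (intro exI[of _ \<phi>])
      (auto simp: carrier_cyclic_homology add_cyclic_homology smult_cyclic_homology \<phi>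
        base_module_def module_hom.add[OF \<epsilon>(1)] module_hom.scale[OF \<epsilon>(1)])
qed

end

section \<open>Linear maps on finitely supported functions\<close>

lemma lookup_pm_scale: "Poly_Mapping.lookup (pm_scale c x) a = c * Poly_Mapping.lookup x a"
  by (simp add: pm_scale_def map.rep_eq when_def)

lemma pm_scale_single [simp]: "pm_scale c (Poly_Mapping.single a d) = Poly_Mapping.single a (c * d)"
  by (simp add: pm_scale_def)

interpretation pm: vector_space pm_scale
  by unfold_locales (auto intro!: poly_mapping_eqI simp: lookup_pm_scale lookup_add algebra_simps)

lemma keys_pm_scale: "Poly_Mapping.keys (pm_scale c x) \<subseteq> Poly_Mapping.keys x"
  by (auto simp: in_keys_iff lookup_pm_scale)

lemma keys_sum_subset:
  fixes f :: "'i \<Rightarrow> ('a \<Rightarrow>\<^sub>0 'b::comm_monoid_add)"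
  assumes "\<And>i. i \<in> I \<Longrightarrow> Poly_Mapping.keys (f i) \<subseteq> A"
  shows "Poly_Mapping.keys (sum f I) \<subseteq> A"
  using assms
proof (induction I rule: infinite_finite_induct)
  case (insert i I)
  then show ?case
    using keys_add[of "f i" "sum f I"] by fastforce
qed auto

lemma lin_ext_superset:
  assumes "finite S" "Poly_Mapping.keys x \<subseteq> S"
  shows "lin_ext f x = (\<Sum>a\<in>S. pm_scale (Poly_Mapping.lookup x a) (f a))"
  unfolding lin_ext_def using assms
  by (intro sum.mono_neutral_left) (auto simp: in_keys_iff)

lemma linear_lin_ext:
  fixes f :: "'a \<Rightarrow> ('b \<Rightarrow>\<^sub>0 'k::field)"
  shows "module_hom pm_scale pm_scale (lin_ext f)"
proof unfold_locales
  fix x y :: "'a \<Rightarrow>\<^sub>0 'k"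
  let ?S = "Poly_Mapping.keys x \<union> Poly_Mapping.keys y"
  have "lin_ext f (x + y) = (\<Sum>a\<in>?S. pm_scale (Poly_Mapping.lookup (x + y) a) (f a))"
    by (rule lin_ext_superset) (auto simp: keys_add)
  also have "\<dots> = lin_ext f x + lin_ext f y"
    by (simp add: lookup_add pm.scale_left_distrib sum.distrib
        lin_ext_superset[of ?S x] lin_ext_superset[of ?S y])
  finally show "lin_ext f (x + y) = lin_ext f x + lin_ext f y" .
next
  fix c x
  have "lin_ext f (pm_scale c x) = (\<Sum>a\<in>Poly_Mapping.keys x. pm_scale (c * Poly_Mapping.lookup x a) (f a))"
    by (subst lin_ext_superset[OF finite_keys keys_pm_scale]) (simp add: lookup_pm_scale)
  then show "lin_ext f (pm_scale c x) = pm_scale c (lin_ext f x)"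
    by (simp add: lin_ext_def pm.scale_sum_right)
qed

lemma lin_ext_single [simp]: "lin_ext f (Poly_Mapping.single a c) = pm_scale c (f a)"
  by (simp add: lin_ext_def)

lemma keys_lin_ext:
  assumes "Poly_Mapping.keys x \<subseteq> A" "\<And>a. a \<in> A \<Longrightarrow> Poly_Mapping.keys (f a) \<subseteq> B"
  shows "Poly_Mapping.keys (lin_ext f x) \<subseteq> B"
  unfolding lin_ext_def using assms
  by (intro keys_sum_subset order_trans[OF keys_pm_scale]) auto

lemma sum_monomials:
  "x = (\<Sum>a\<in>Poly_Mapping.keys x. pm_scale (Poly_Mapping.lookup x a) (Poly_Mapping.single a 1))"
proof (rule poly_mapping_eqI)
  fix a
  show "Poly_Mapping.lookup x a = Poly_Mapping.lookup
    (\<Sum>a\<in>Poly_Mapping.keys x. pm_scale (Poly_Mapping.lookup x a) (Poly_Mapping.single a 1)) a"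
    by (simp add: lookup_sum lookup_single when_def sum.delta in_keys_iff)
qed

lemma linear_eq_on_basis:
  assumes "module_hom pm_scale s f" "module_hom pm_scale s g"
    and "Poly_Mapping.keys x \<subseteq> A"
    and "\<And>a. a \<in> A \<Longrightarrow> f (Poly_Mapping.single a 1) = g (Poly_Mapping.single a 1)"
  shows "f x = g x"
proof -
  interpret f: module_hom pm_scale s f by fact
  interpret g: module_hom pm_scale s g by fact
  have "f (\<Sum>a\<in>Poly_Mapping.keys x. pm_scale (Poly_Mapping.lookup x a) (Poly_Mapping.single a 1))
      = g (\<Sum>a\<in>Poly_Mapping.keys x. pm_scale (Poly_Mapping.lookup x a) (Poly_Mapping.single a 1))"
    unfolding f.sum g.sum f.scale g.scale using assms(3,4) by (intro sum.cong) auto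
  then show ?thesis
    by (simp only: sum_monomials[of x, symmetric])
qed

lemma linear_o: "module_hom pm_scale pm_scale f \<Longrightarrow> module_hom pm_scale pm_scale g \<Longrightarrow>
    module_hom pm_scale pm_scale (\<lambda>x. f (g x))"
  using module_hom_compose[of pm_scale pm_scale g pm_scale f] by (simp add: o_def)

lemma linear_pm_ident: "module_hom pm_scale pm_scale (\<lambda>x. x)"
  by unfold_locales auto

section \<open>The twisted cyclic module of a commutative group algebra\<close>

text \<open>
  For commutative \<open>G\<close>, products are unchanged by cyclic rotation of the factors, so the rotation
  by \<open>t\<^sub>n\<close> preserves the condition that the completed tuple has product \<open>\<pi>\<close>.
\<close>
locale twisted_group_algebra = comm_group G for G (structure) +
  fixes \<pi> :: 'a and \<alpha> \<beta> :: "('a \<Rightarrow>\<^sub>0 'k::field) \<Rightarrow> 'k"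
  assumes \<alpha>: "\<alpha> \<in> characters G" and \<beta>: "\<beta> \<in> characters G"
    and \<pi>: "\<pi> \<in> carrier G" and \<alpha>_\<pi>: "\<alpha> (grp_elt \<pi>) = 1" and \<beta>_\<pi>: "\<beta> (grp_elt \<pi>) = 1"
begin

lemma character_mult:
  assumes "\<gamma> \<in> characters G" "g \<in> carrier G" "h \<in> carrier G"
  shows "\<gamma> (grp_elt (g \<otimes> h)) = \<gamma> (grp_elt g) * (\<gamma> (grp_elt h) :: 'k)"
proof -
  have "\<gamma> (grp_elt g \<otimes>\<^bsub>group_algebra G\<^esub> grp_elt h) = \<gamma> (grp_elt g) \<otimes>\<^bsub>base_module\<^esub> \<gamma> (grp_elt h)"
    using assms by (intro ring_hom_mult) (auto simp: characters_def group_algebra_def grp_elt_def)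
  then show ?thesis
    by (simp add: group_algebra_def base_module_def grp_elt_def)
qed

lemma character_one: "\<gamma> \<in> characters G \<Longrightarrow> \<gamma> (grp_elt \<one>) = (1 :: 'k)"
  using ring_hom_one[of \<gamma> "group_algebra G" base_module]
  by (simp add: characters_def group_algebra_def base_module_def grp_elt_def)

lemma character_nonzero:
  assumes "\<gamma> \<in> characters G" "g \<in> carrier G"
  shows "\<gamma> (grp_elt g) \<noteq> (0 :: 'k)"
  using character_mult[OF assms inv_closed[OF assms(2)]] character_one[OF assms(1)] assms(2)
  by auto

lemma character_inv:
  assumes "\<gamma> \<in> characters G" "g \<in> carrier G"
  shows "\<gamma> (grp_elt (inv g)) = (1 / \<gamma> (grp_elt g) :: 'k)"
  using character_mult[OF assms inv_closed[OF assms(2)]] character_one[OF assms(1)] assms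
    character_nonzero[OF assms]
  by (simp add: field_simps)

text \<open>
  The twisted module uses the characters only through their values on group elements.
\<close>
abbreviation a :: "'a \<Rightarrow> 'k" where "a g \<equiv> \<alpha> (grp_elt g)"
abbreviation b :: "'a \<Rightarrow> 'k" where "b g \<equiv> \<beta> (grp_elt g)"

lemmas character_simps = character_mult[OF \<alpha>] character_mult[OF \<beta>]
  character_one[OF \<alpha>] character_one[OF \<beta>] character_nonzero[OF \<alpha>] character_nonzero[OF \<beta>]
  character_inv[OF \<alpha>] character_inv[OF \<beta>] \<alpha>_\<pi> \<beta>_\<pi>

text \<open>
  Characters are linear and the group elements span the group algebra.
\<close>
lemma character_determined:
  assumes \<gamma>: "\<gamma> \<in> characters G" "\<gamma>' \<in> characters G"
    and eq: "\<And>g. g \<in> carrier G \<Longrightarrow> \<gamma> (grp_elt g) = (\<gamma>' (grp_elt g) :: 'k)"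
  shows "\<gamma> = \<gamma>'"
proof -
  have sum: "\<gamma> (\<Sum>g\<in>S. pm_scale (f g) (grp_elt g)) = (\<Sum>g\<in>S. f g * \<gamma> (grp_elt g))"
    if \<gamma>: "\<gamma> \<in> characters G" and S: "finite S" "S \<subseteq> carrier G"
    for \<gamma> :: "('a \<Rightarrow>\<^sub>0 'k) \<Rightarrow> 'k" and S f
    using S
  proof induction
    case empty
    have "\<gamma> (0 \<oplus>\<^bsub>group_algebra G\<^esub> 0) = \<gamma> 0 \<oplus>\<^bsub>base_module\<^esub> \<gamma> 0"
      using \<gamma> by (intro ring_hom_add) (auto simp: characters_def group_algebra_def)
    then have "\<gamma> 0 = \<gamma> 0 + \<gamma> 0"
      by (simp add: group_algebra_def base_module_def)
    then have "\<gamma> 0 = 0"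
      by (simp only: add_cancel_right_right)
    then show ?case
      by simp
  next
    case (insert g S)
    let ?s = "\<Sum>h\<in>S. pm_scale (f h) (grp_elt h)"
    have g: "grp_elt g \<in> carrier (group_algebra G)"
      "pm_scale (f g) (grp_elt g) \<in> carrier (group_algebra G)"
      using insert.prems by (auto simp: group_algebra_def grp_elt_def split: if_splits)
    have "Poly_Mapping.keys ?s \<subseteq> carrier G"
      using insert.prems
      by (intro keys_sum_subset order_trans[OF keys_pm_scale]) (auto simp: grp_elt_def)
    then have "?s \<in> carrier (group_algebra G)"
      by (simp add: group_algebra_def)
    then have "\<gamma> (pm_scale (f g) (grp_elt g) \<oplus>\<^bsub>group_algebra G\<^esub> ?s)
        = \<gamma> (pm_scale (f g) (grp_elt g)) \<oplus>\<^bsub>base_module\<^esub> \<gamma> ?s"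
      using \<gamma> g by (intro ring_hom_add) (auto simp: characters_def)
    moreover have "\<gamma> (pm_scale (f g) (grp_elt g)) = f g * \<gamma> (grp_elt g)"
      using \<gamma> g(1) by (auto simp: characters_def group_algebra_def base_module_def)
    ultimately show ?case
      using insert by (simp add: group_algebra_def base_module_def)
  qed
  show ?thesis
  proof (rule extensionalityI)
    show "\<gamma> \<in> extensional (carrier (group_algebra G))" "\<gamma>' \<in> extensional (carrier (group_algebra G))"
      using \<gamma> by (auto simp: characters_def)
    fix x :: "'a \<Rightarrow>\<^sub>0 'k" assume "x \<in> carrier (group_algebra G)"
    then have keys: "Poly_Mapping.keys x \<subseteq> carrier G"
      by (simp add: group_algebra_def)
    let ?s = "\<Sum>g\<in>Poly_Mapping.keys x. pm_scale (Poly_Mapping.lookup x g) (grp_elt g)"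
    have "\<gamma> ?s = \<gamma>' ?s"
      using eq keys sum[OF \<gamma>(1) finite_keys keys] sum[OF \<gamma>(2) finite_keys keys]
      by (auto intro!: sum.cong)
    then show "\<gamma> x = \<gamma>' x"
      using sum_monomials[of x] by (simp add: grp_elt_def)
  qed
qed

abbreviation CM :: "('k, 'a list \<Rightarrow>\<^sub>0 'k) cyclic_data" where
  "CM \<equiv> CM_module G \<pi> \<alpha> \<beta>"

definition tuples :: "nat \<Rightarrow> 'a list set" where
  "tuples n = {gs. length gs = n \<and> set gs \<subseteq> carrier G}"

lemma CM_sel [simp]:
  "scl CM = pm_scale" "obj CM n = {x. Poly_Mapping.keys x \<subseteq> tuples n}"
  "face CM n i = lin_ext (CM_face G \<alpha> \<beta> n i)" "cyc CM n = lin_ext (CM_cyc G \<pi> \<alpha> \<beta> n)"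
  by (simp_all add: CM_module_def tuples_def)

lemma list_mult_simps [simp]:
  "list_mult G [] = \<one>" "list_mult G (g # gs) = g \<otimes> list_mult G gs"
  by (simp_all add: list_mult_def)

lemma list_mult_closed: "set gs \<subseteq> carrier G \<Longrightarrow> list_mult G gs \<in> carrier G"
  by (induction gs) auto

lemma list_mult_append:
  "set gs \<subseteq> carrier G \<Longrightarrow> set hs \<subseteq> carrier G \<Longrightarrow>
    list_mult G (gs @ hs) = list_mult G gs \<otimes> list_mult G hs"
  by (induction gs) (auto simp: list_mult_closed m_assoc)

lemma CM_face_inner:
  assumes "length us = i" "i + 2 \<le> n"
  shows "CM_face G \<alpha> \<beta> n (Suc i) (us @ x # y # vs) = Poly_Mapping.single (us @ (x \<otimes> y) # vs) 1"
  using assms by (simp add: CM_face_def nth_append)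

lemma tuples_splitE:
  assumes "gs \<in> tuples n" "Suc i < n"
  obtains us x y vs where "gs = us @ x # y # vs" "length us = i"
    "length vs = n - i - 2" "set us \<subseteq> carrier G" "x \<in> carrier G" "y \<in> carrier G" "set vs \<subseteq> carrier G"
proof -
  have len: "length gs = n" and car: "set gs \<subseteq> carrier G"
    using assms by (auto simp: tuples_def)
  have gs: "gs = take i gs @ gs ! i # gs ! Suc i # drop (Suc (Suc i)) gs"
    using len assms(2) by (simp add: Cons_nth_drop_Suc)
  show thesis
    by (rule that[OF gs])
      (use len car assms(2) in \<open>auto dest: in_set_takeD in_set_dropD\<close>)
qed

lemma tuples_snocE:
  assumes "gs \<in> tuples (Suc n)"
  obtains us x where "gs = us @ [x]" "us \<in> tuples n" "x \<in> carrier G"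
  using assms by (cases gs rule: rev_cases) (auto simp: tuples_def)

lemma tuples_ConsE:
  assumes "gs \<in> tuples (Suc n)"
  obtains x us where "gs = x # us" "us \<in> tuples n" "x \<in> carrier G"
  using assms by (cases gs) (auto simp: tuples_def)

lemma keys_CM_cyc:
  assumes "gs \<in> tuples n"
  shows "Poly_Mapping.keys (CM_cyc G \<pi> \<alpha> \<beta> n gs) \<subseteq> tuples n"
proof (cases n)
  case (Suc m)
  with assms obtain us x where "gs = us @ [x]" "us \<in> tuples m" "x \<in> carrier G"
    by (metis tuples_snocE)
  then show ?thesis
    using Suc \<pi> by (auto simp: CM_cyc_def tuples_def list_mult_append list_mult_closed)
qed (use assms in \<open>simp add: CM_cyc_def\<close>)

lemma face_0_cyc_basis:
  assumes "gs \<in> tuples (Suc n)"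
  shows "lin_ext (CM_face G \<alpha> \<beta> (Suc n) 0) (CM_cyc G \<pi> \<alpha> \<beta> (Suc n) gs)
    = CM_face G \<alpha> \<beta> (Suc n) (Suc n) gs"
proof -
  have "list_mult G gs \<in> carrier G"
    using assms by (simp add: tuples_def list_mult_closed)
  then show ?thesis
    using \<pi> by (simp add: CM_cyc_def CM_face_def character_simps)
qed

lemma inv_cancel_product:
  assumes "x \<in> carrier G" "y \<in> carrier G" "z \<in> carrier G"
  shows "x \<otimes> inv (y \<otimes> z) \<otimes> y = x \<otimes> inv z"
proof -
  have "x \<otimes> inv (y \<otimes> z) \<otimes> y = x \<otimes> inv z \<otimes> (inv y \<otimes> y)"
    using assms by (simp only: inv_mult m_ac inv_closed m_closed)
  then show ?thesis
    using assms by simp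
qed

lemma face_Suc_cyc_basis:
  assumes "i \<le> n" and gs: "gs \<in> tuples (Suc n)"
  shows "lin_ext (CM_face G \<alpha> \<beta> (Suc n) (Suc i)) (CM_cyc G \<pi> \<alpha> \<beta> (Suc n) gs)
    = lin_ext (CM_cyc G \<pi> \<alpha> \<beta> n) (CM_face G \<alpha> \<beta> (Suc n) i gs)"
proof (cases i)
  case 0
  obtain g hs where g: "gs = g # hs" "hs \<in> tuples n" "g \<in> carrier G"
    using gs by (rule tuples_ConsE)
  show ?thesis
  proof (cases n)
    case 0
    with \<open>i = 0\<close> g \<pi> show ?thesis
      by (simp add: tuples_def CM_face_def CM_cyc_def character_simps)
  next
    case (Suc m)
    then obtain ws x where x: "hs = ws @ [x]" "ws \<in> tuples m" "x \<in> carrier G"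
      using g(2) by (metis tuples_snocE)
    then have "list_mult G hs \<in> carrier G"
      by (simp add: tuples_def list_mult_closed)
    then show ?thesis
      using 0 Suc x(1,2) g(1,3) \<pi>
      by (simp add: CM_cyc_def CM_face_def character_simps inv_cancel_product
          tuples_def butlast_append mult.assoc)
  qed
next
  case (Suc j)
  have j: "Suc j < Suc n"
    using Suc \<open>i \<le> n\<close> by simp
  obtain us x y vs where gs_eq: "gs = us @ x # y # vs" and len: "length us = j" "length vs = Suc n - j - 2"
    and car: "set us \<subseteq> carrier G" "x \<in> carrier G" "y \<in> carrier G" "set vs \<subseteq> carrier G"
    using tuples_splitE[OF gs j] .
  have m: "list_mult G us \<in> carrier G" "list_mult G vs \<in> carrier G"
    using car by (simp_all add: list_mult_closed)
  have eq: "list_mult G (us @ x # y # vs) = list_mult G (us @ (x \<otimes> y) # vs)"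
    using car m by (simp add: list_mult_append m_assoc)
  have face: "CM_face G \<alpha> \<beta> (Suc n) i gs = Poly_Mapping.single (us @ (x \<otimes> y) # vs) 1"
    using Suc \<open>i \<le> n\<close> len by (simp add: gs_eq CM_face_inner)
  let ?c = "\<pi> \<otimes> inv (list_mult G gs)"
  show ?thesis
  proof (cases vs rule: rev_cases)
    case Nil
    then have n: "n = Suc j" "i = n"
      using len Suc \<open>i \<le> n\<close> by auto
    show ?thesis
      unfolding face using n car
      by (simp add: gs_eq Nil CM_cyc_def CM_face_def eq[unfolded Nil]
          butlast_append character_simps mult_ac)
  next
    case (snoc ws v)
    have face': "CM_face G \<alpha> \<beta> (Suc n) (Suc (Suc j)) ((?c # us) @ x # y # ws)
        = Poly_Mapping.single ((?c # us) @ (x \<otimes> y) # ws) 1"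
      using len snoc by (intro CM_face_inner) auto
    show ?thesis
      unfolding face using face' Suc len j
      by (simp add: gs_eq snoc CM_cyc_def eq[unfolded snoc] butlast_append)
  qed
qed

text \<open>
  Completing \<open>(g\<^sub>1, \<dots>, g\<^sub>n)\<close> by \<open>g\<^sub>0 = \<pi> (g\<^sub>1 \<dots> g\<^sub>n)\<^sup>-\<^sup>1\<close> gives \<open>n + 1\<close> elements with product \<open>\<pi>\<close>,
  on which \<open>t\<^sub>n\<close> is a cyclic rotation with a scalar factor. The factor is
  \<open>\<beta>(g\<^sub>n) / \<alpha>(g\<^sub>0)\<close>, since \<open>\<alpha>(g\<^sub>0) \<alpha>(g\<^sub>1 \<dots> g\<^sub>n) = \<alpha>(\<pi>) = 1\<close>.
\<close>
lemma cyc_rotate_once: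
  assumes e: "set (us @ [v]) \<subseteq> carrier G" "list_mult G (us @ [v]) = \<pi>" "length us = n"
  shows "CM_cyc G \<pi> \<alpha> \<beta> n (tl (us @ [v]))
    = Poly_Mapping.single (tl (v # us)) (b v / a (hd (us @ [v])))"
proof (cases us)
  case Nil
  with e show ?thesis
    by (simp add: CM_cyc_def character_simps)
next
  case (Cons h ws)
  let ?p = "list_mult G (ws @ [v])"
  have p: "?p \<in> carrier G"
    using e(1) Cons by (intro list_mult_closed) auto
  have h: "h \<in> carrier G" and hp: "\<pi> = h \<otimes> ?p"
    using e Cons by auto
  have "h = \<pi> \<otimes> inv ?p"
    using p h hp by (simp add: m_assoc)
  moreover have "1 = a h * a ?p"
    using \<alpha>_\<pi> p h by (simp add: hp character_simps)
  then have "a ?p = 1 / a h"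
    using h by (simp add: character_simps field_simps)
  ultimately show ?thesis
    using Cons e(3) by (simp add: CM_cyc_def butlast_append del: list_mult_simps)
qed

text \<open>
  The factor \<open>\<beta>(g\<^sub>n) / \<alpha>(g\<^sub>0)\<close> equals \<open>(\<beta> / \<alpha>)(g\<^sub>n)\<close> times the quotient of the values of
  \<open>\<alpha>\<close> at the new and the old first entry. The quotients telescope under iteration, so moving a
  block \<open>vs\<close> to the front costs \<open>(\<beta> / \<alpha>)\<close> of its product and a single such quotient.
\<close>
lemma cyc_rotate:
  assumes "set (us @ vs) \<subseteq> carrier G" "list_mult G (us @ vs) = \<pi>" "length (us @ vs) = Suc n"
  shows "(lin_ext (CM_cyc G \<pi> \<alpha> \<beta> n) ^^ length vs) (Poly_Mapping.single (tl (us @ vs)) 1)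
    = Poly_Mapping.single (tl (vs @ us))
      (b (list_mult G vs) / a (list_mult G vs) * a (hd (vs @ us)) / a (hd (us @ vs)))"
  using assms
proof (induction vs arbitrary: us)
  case Nil
  then have "us \<noteq> []"
    by auto
  with Nil.prems(1) have "hd us \<in> carrier G"
    using hd_in_set[of us] by auto
  with \<open>us \<noteq> []\<close> show ?case
    by (simp add: character_simps)
next
  case (Cons v vs)
  have car: "v \<in> carrier G" "set vs \<subseteq> carrier G" "set us \<subseteq> carrier G" "list_mult G vs \<in> carrier G"
    "list_mult G us \<in> carrier G"
    using Cons.prems(1) by (auto intro: list_mult_closed)
  have mult: "list_mult G ((vs @ us) @ [v]) = \<pi>"
    using Cons.prems(2) car by (simp add: list_mult_append m_ac)
  have hd: "a (hd ((vs @ us) @ [v])) \<noteq> 0" "a (hd (us @ v # vs)) \<noteq> 0"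
    using car by (cases vs; cases us; simp add: character_simps)+
  let ?T = "lin_ext (CM_cyc G \<pi> \<alpha> \<beta> n)"
  let ?w = "b (list_mult G vs) / a (list_mult G vs) * a (hd ((vs @ us) @ [v])) / a (hd (us @ v # vs))"
  have "(?T ^^ length (v # vs)) (Poly_Mapping.single (tl (us @ v # vs)) 1)
      = ?T (Poly_Mapping.single (tl ((vs @ us) @ [v])) ?w)"
    using Cons.IH[of "us @ [v]"] Cons.prems by simp
  also have "\<dots> = Poly_Mapping.single (tl (v # vs @ us)) (?w * (b v / a (hd ((vs @ us) @ [v]))))"
    using car mult Cons.prems(3)
    by (simp only: lin_ext_single, subst cyc_rotate_once) auto
  also have "?w * (b v / a (hd ((vs @ us) @ [v])))
      = b (list_mult G (v # vs)) / a (list_mult G (v # vs)) * a (hd ((v # vs) @ us)) / a (hd (us @ v # vs))"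
    using car hd by (simp add: character_simps field_simps)
  finally show ?case
    by simp
qed

text \<open>
  A full rotation costs \<open>(\<beta> / \<alpha>)(\<pi>)\<close>. This is where \<open>\<alpha>(\<pi>) = \<beta>(\<pi>) = 1\<close> enters.
\<close>
lemma cyc_power_basis:
  assumes "gs \<in> tuples n"
  shows "(lin_ext (CM_cyc G \<pi> \<alpha> \<beta> n) ^^ Suc n) (Poly_Mapping.single gs 1) = Poly_Mapping.single gs 1"
proof -
  define e where "e = (\<pi> \<otimes> inv (list_mult G gs)) # gs"
  have p: "list_mult G gs \<in> carrier G" and gs: "set gs \<subseteq> carrier G" "length gs = n"
    using assms by (auto simp: tuples_def list_mult_closed)
  have e: "set e \<subseteq> carrier G" "list_mult G e = \<pi>" "length e = Suc n"
    using p gs \<pi> by (auto simp: e_def m_assoc)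
  show ?thesis
    using cyc_rotate[of "[]" e n] e p \<pi> by (simp add: e_def character_simps del: funpow.simps)
qed

sublocale cyclic_operators CM
proof (intro cyclic_operators.intro cyclic_operators_axioms.intro, unfold CM_sel)
  show "vector_space pm_scale"
    by (rule pm.vector_space_axioms)
  show "module_hom pm_scale pm_scale (lin_ext (CM_face G \<alpha> \<beta> n i))"
    "module_hom pm_scale pm_scale (lin_ext (CM_cyc G \<pi> \<alpha> \<beta> n))" for n i
    by (rule linear_lin_ext)+
  show "pm.subspace {x. Poly_Mapping.keys x \<subseteq> tuples n}" for n
    unfolding pm.subspace_def
    by (auto dest!: keys_add[THEN subsetD] keys_pm_scale[THEN subsetD])
  fix x :: "'a list \<Rightarrow>\<^sub>0 'k" and n i :: nat
  show "lin_ext (CM_cyc G \<pi> \<alpha> \<beta> n) x \<in> {x. Poly_Mapping.keys x \<subseteq> tuples n}"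
    if "x \<in> {x. Poly_Mapping.keys x \<subseteq> tuples n}"
    using that keys_lin_ext[of x "tuples n" "CM_cyc G \<pi> \<alpha> \<beta> n"] keys_CM_cyc by blast
  show "(lin_ext (CM_cyc G \<pi> \<alpha> \<beta> n) ^^ Suc n) x = x"
    if "x \<in> {x. Poly_Mapping.keys x \<subseteq> tuples n}"
    by (rule linear_eq_on_basis[OF linear_funpow[OF linear_lin_ext] linear_pm_ident,
          where A = "tuples n"])
      (use that in \<open>simp_all only: cyc_power_basis mem_Collect_eq\<close>)
  assume x: "x \<in> {x. Poly_Mapping.keys x \<subseteq> tuples (Suc n)}"
  show "lin_ext (CM_face G \<alpha> \<beta> (Suc n) 0) (lin_ext (CM_cyc G \<pi> \<alpha> \<beta> (Suc n)) x)
      = lin_ext (CM_face G \<alpha> \<beta> (Suc n) (Suc n)) x"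
    by (rule linear_eq_on_basis[OF linear_o[OF linear_lin_ext linear_lin_ext] linear_lin_ext,
          where A = "tuples (Suc n)"])
      (use x face_0_cyc_basis in auto)
  show "lin_ext (CM_face G \<alpha> \<beta> (Suc n) (Suc i)) (lin_ext (CM_cyc G \<pi> \<alpha> \<beta> (Suc n)) x)
      = lin_ext (CM_cyc G \<pi> \<alpha> \<beta> n) (lin_ext (CM_face G \<alpha> \<beta> (Suc n) i) x)" if "i \<le> n"
    by (rule linear_eq_on_basis[OF linear_o[OF linear_lin_ext linear_lin_ext]
          linear_o[OF linear_lin_ext linear_lin_ext], where A = "tuples (Suc n)"])
      (use x face_Suc_cyc_basis[OF that] in auto)
qed

end

section \<open>Exactness of the odd columns\<close>

context twisted_group_algebra
begin

definition append_one :: "('a list \<Rightarrow>\<^sub>0 'k) \<Rightarrow> ('a list \<Rightarrow>\<^sub>0 'k)" where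
  "append_one = lin_ext (\<lambda>gs. Poly_Mapping.single (gs @ [\<one>]) 1)"

lemma face_append_one_basis:
  assumes "i < q" and gs: "gs \<in> tuples q"
  shows "CM_face G \<alpha> \<beta> (Suc q) i (gs @ [\<one>]) = append_one (CM_face G \<alpha> \<beta> q i gs)"
proof (cases i)
  case 0
  with assms have "gs \<noteq> []"
    by (auto simp: tuples_def)
  with 0 show ?thesis
    by (simp add: CM_face_def append_one_def)
next
  case (Suc j)
  obtain us x y vs where "gs = us @ x # y # vs" "length us = j"
    using tuples_splitE[OF gs, of j] Suc assms(1) by metis
  then show ?thesis
    using assms(1) Suc CM_face_inner[of us j "Suc q" x y "vs @ [\<one>]"]
    by (simp add: CM_face_inner append_one_def)
qed

lemma face_last_append_one_basis:
  assumes gs: "gs \<in> tuples q"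
  shows "CM_face G \<alpha> \<beta> (Suc q) q (gs @ [\<one>]) = Poly_Mapping.single gs 1"
proof (cases q)
  case 0
  with gs show ?thesis
    by (simp add: tuples_def CM_face_def character_simps)
next
  case (Suc j)
  with gs obtain us x where "gs = us @ [x]" "us \<in> tuples j" "x \<in> carrier G"
    by (metis tuples_snocE)
  then show ?thesis
    using Suc by (simp add: CM_face_inner tuples_def)
qed

lemma linear_append_one: "module_hom pm_scale pm_scale append_one"
  unfolding append_one_def by (rule linear_lin_ext)

lemma append_one_single:
  "append_one (Poly_Mapping.single gs 1) = Poly_Mapping.single (gs @ [\<one>]) 1"
  by (simp add: append_one_def)

lemma append_one_in_obj: "x \<in> obj CM q \<Longrightarrow> append_one x \<in> obj CM (Suc q)"
  unfolding append_one_def CM_sel mem_Collect_eq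
  by (erule keys_lin_ext) (auto simp: tuples_def)

text \<open>
  Appending the unit commutes with every face except the last one occurring in \<open>b'\<close>, which
  removes the unit again. So it contracts the columns \<open>(C, b')\<close> up to sign, in row \<open>0\<close> too.
\<close>
lemma hoch_b'_append_one:
  assumes x: "x \<in> obj CM q"
  shows "hoch_b' CM (Suc q) (append_one x)
    = append_one (hoch_b' CM q x) + pm_scale ((- 1) ^ q) x"
proof -
  interpret S: module_hom pm_scale pm_scale append_one
    by (rule linear_append_one)
  have inner: "face CM (Suc q) i (append_one x) = append_one (face CM q i x)" if "i < q" for i
    unfolding CM_sel
    by (rule linear_eq_on_basis[OF linear_o[OF linear_lin_ext linear_append_one]
          linear_o[OF linear_append_one linear_lin_ext], where A = "tuples q"])
      (use x in \<open>auto simp: append_one_single face_append_one_basis[OF that]\<close>)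
  have last: "face CM (Suc q) q (append_one x) = x"
    unfolding CM_sel
    by (rule linear_eq_on_basis[OF linear_o[OF linear_lin_ext linear_append_one]
          linear_pm_ident, where A = "tuples q"])
      (use x in \<open>auto simp: append_one_single face_last_append_one_basis\<close>)
  show ?thesis
    unfolding hoch_b'_def sum.lessThan_Suc last S.sum
    by (simp add: inner[unfolded CM_sel] S.scale)
qed

lemma exact_at_odd_column:
  assumes "odd p"
  shows "exact_at p q"
  unfolding exact_at_def
proof (intro ballI impI)
  fix z assume z: "z \<in> obj CM q" and "q = 0 \<or> vert CM p q z = 0"
  then have cycle: "hoch_b' CM q z = 0"
    using assms by (auto simp: vert_def hoch_b'_def)
  let ?y = "pm_scale (- ((- 1) ^ q)) (append_one z)"
  have "?y \<in> obj CM (Suc q)"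
    using append_one_in_obj[OF z] subspace_obj[of "Suc q"] by (simp only: CM_sel(1) pm.subspace_scale)
  moreover have "vert CM p (Suc q) ?y = z"
    using assms hoch_b'_append_one[OF z] cycle
      module_hom.scale[OF linear_hoch_b'[of "Suc q"]] module_hom.neg[OF linear_hoch_b'[of "Suc q"]]
      module_hom.zero[OF linear_append_one]
    by (simp add: vert_def)
  ultimately show "\<exists>y \<in> obj CM (Suc q). vert CM p (Suc q) y = z"
    by blast
qed

end

section \<open>Exactness of the even columns\<close>

locale twisted_finite_group_algebra = twisted_group_algebra G \<pi> \<alpha> \<beta>
  for G (structure) and \<pi> :: 'a and \<alpha> \<beta> :: "('a \<Rightarrow>\<^sub>0 'k::field) \<Rightarrow> 'k" +
  assumes finite_carrier: "finite (carrier G)"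
    and order_nonzero: "of_nat (order G) \<noteq> (0 :: 'k)"
begin

text \<open>
  Averaging against \<open>\<alpha>\<^sup>-\<^sup>1\<close> produces an element \<open>e\<close> of \<open>kG\<close> with \<open>\<alpha>(e) = 1\<close> and \<open>e g = \<alpha>(g) e\<close>. It
  exists because the order of \<open>G\<close> is invertible in \<open>k\<close>.
\<close>
definition weight :: "'a \<Rightarrow> 'k" where
  "weight g = 1 / (of_nat (order G) * a g)"

definition average :: "('a list \<Rightarrow>\<^sub>0 'k) \<Rightarrow> ('a list \<Rightarrow>\<^sub>0 'k)" where
  "average = lin_ext (\<lambda>gs. \<Sum>g\<in>carrier G. Poly_Mapping.single (g # gs) (weight g))"

lemma sum_single_same:
  "(\<Sum>g\<in>A. Poly_Mapping.single u (f g)) = Poly_Mapping.single u (\<Sum>g\<in>A. f g)"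
  by (rule poly_mapping_eqI) (simp add: lookup_sum lookup_single when_def)

lemma lin_ext_average_basis:
  "lin_ext F (average (Poly_Mapping.single gs 1))
    = (\<Sum>g\<in>carrier G. pm_scale (weight g) (F (g # gs)))"
  by (simp add: average_def module_hom.sum[OF linear_lin_ext])

lemma sum_weight_a: "(\<Sum>g\<in>carrier G. weight g * a g) = 1"
proof -
  have "(\<Sum>g\<in>carrier G. weight g * a g) = (\<Sum>g\<in>carrier G. 1 / of_nat (order G))"
    by (intro sum.cong) (simp_all add: weight_def character_simps)
  also have "\<dots> = 1"
    using order_nonzero by (simp add: order_def)
  finally show ?thesis .
qed

text \<open>
  Orthogonality of characters: \<open>\<beta>(e) = 0\<close> if \<open>\<alpha> \<noteq> \<beta>\<close>, since translating the sum by \<open>h\<close>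
  multiplies it by \<open>\<beta>(h) / \<alpha>(h)\<close>.
\<close>
lemma sum_weight_b:
  assumes "\<alpha> \<noteq> \<beta>"
  shows "(\<Sum>g\<in>carrier G. weight g * b g) = 0"
proof -
  obtain h where h: "h \<in> carrier G" "a h \<noteq> b h"
    using character_determined[OF \<alpha> \<beta>] assms by blast
  let ?s = "\<Sum>g\<in>carrier G. weight g * b g"
  have "?s = (\<Sum>g\<in>carrier G. weight (g \<otimes> h) * b (g \<otimes> h))"
    by (rule sum.reindex_bij_witness[where i = "\<lambda>g. g \<otimes> h" and j = "\<lambda>g. g \<otimes> inv h"])
      (auto simp: h m_assoc)
  also have "\<dots> = (\<Sum>g\<in>carrier G. weight g * b g * (b h / a h))"
    by (intro sum.cong) (simp_all add: weight_def character_simps h)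
  also have "\<dots> = ?s * (b h / a h)"
    by (simp only: sum_distrib_right)
  finally have "?s * (b h / a h - 1) = 0"
    by (simp add: right_diff_distrib)
  then show ?thesis
    using h by (simp add: character_simps field_simps)
qed

lemma face_0_average_basis:
  "lin_ext (CM_face G \<alpha> \<beta> (Suc q) 0) (average (Poly_Mapping.single gs 1)) = Poly_Mapping.single gs 1"
  by (simp add: lin_ext_average_basis CM_face_def sum_single_same sum_weight_a)

lemma face_Suc_average_basis:
  assumes "i \<le> q" "0 < q" and gs: "gs \<in> tuples q"
  shows "lin_ext (CM_face G \<alpha> \<beta> (Suc q) (Suc i)) (average (Poly_Mapping.single gs 1))
    = average (CM_face G \<alpha> \<beta> q i gs)"
proof -
  consider "i = 0" | "i = q" "0 < q" | j where "i = Suc j" "Suc j < q"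
    using assms by (cases i) force+
  then show ?thesis
  proof cases
    case 1
    obtain x hs where x: "gs = x # hs" "hs \<in> tuples (q - 1)" "x \<in> carrier G"
      using gs \<open>0 < q\<close> by (metis Suc_pred' tuples_ConsE)
    have face: "CM_face G \<alpha> \<beta> (Suc q) (Suc 0) (g # gs) = Poly_Mapping.single ((g \<otimes> x) # hs) 1" for g
      using CM_face_inner[of "[]" 0 "Suc q" g x hs] \<open>0 < q\<close> x by simp
    have "lin_ext (CM_face G \<alpha> \<beta> (Suc q) (Suc i)) (average (Poly_Mapping.single gs 1))
        = (\<Sum>g\<in>carrier G. Poly_Mapping.single ((g \<otimes> x) # hs) (weight g))"
      by (simp add: 1 lin_ext_average_basis face)
    also have "\<dots> = (\<Sum>g\<in>carrier G. Poly_Mapping.single (g # hs) (a x * weight g))"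
      by (rule sum.reindex_bij_witness[where i = "\<lambda>g. g \<otimes> inv x" and j = "\<lambda>g. g \<otimes> x"])
        (auto simp: x m_assoc weight_def character_simps)
    also have "\<dots> = average (CM_face G \<alpha> \<beta> q i gs)"
      by (simp add: 1 CM_face_def x average_def pm.scale_sum_right)
    finally show ?thesis .
  next
    case 2
    then have "gs \<noteq> []"
      using gs by (auto simp: tuples_def)
    then show ?thesis
      using 2 by (simp add: lin_ext_average_basis CM_face_def)
        (simp add: average_def pm.scale_sum_right mult.commute)
  next
    case 3
    obtain us x y vs where split: "gs = us @ x # y # vs" "length us = j"
      using tuples_splitE[OF gs 3(2)] by metis
    then have "CM_face G \<alpha> \<beta> (Suc q) (Suc i) (g # gs)
        = Poly_Mapping.single (g # us @ (x \<otimes> y) # vs) 1" for g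
      using 3 CM_face_inner[of "g # us" i "Suc q" x y vs] by simp
    then show ?thesis
      using 3 split by (simp add: lin_ext_average_basis CM_face_inner) (simp add: average_def)
  qed
qed

lemma linear_average: "module_hom pm_scale pm_scale average"
  unfolding average_def by (rule linear_lin_ext)

lemma average_in_obj: "x \<in> obj CM q \<Longrightarrow> average x \<in> obj CM (Suc q)"
  unfolding average_def CM_sel mem_Collect_eq
  by (erule keys_lin_ext, rule keys_sum_subset) (auto simp: tuples_def)

text \<open>
  Prepending the averaging element \<open>e\<close> contracts \<open>(C, b)\<close> in positive degrees: \<open>\<alpha>(e) = 1\<close> makes
  \<open>d\<^sub>0\<close> a left inverse, and \<open>e g\<^sub>1 = \<alpha>(g\<^sub>1) e\<close> turns \<open>d\<^sub>1\<close> into \<open>d\<^sub>0\<close> applied before prepending.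
\<close>
lemma hoch_b_average:
  assumes x: "x \<in> obj CM q" and q: "0 < q"
  shows "hoch_b CM (Suc q) (average x) = x - average (hoch_b CM q x)"
proof -
  interpret h: module_hom pm_scale pm_scale average
    by (rule linear_average)
  have first: "face CM (Suc q) 0 (average x) = x"
    unfolding CM_sel
    by (rule linear_eq_on_basis[OF linear_o[OF linear_lin_ext linear_average] linear_pm_ident,
          where A = "tuples q"])
      (use x face_0_average_basis in auto)
  have inner: "face CM (Suc q) (Suc i) (average x) = average (face CM q i x)" if "i \<le> q" for i
    unfolding CM_sel
    by (rule linear_eq_on_basis[OF linear_o[OF linear_lin_ext linear_average]
          linear_o[OF linear_average linear_lin_ext], where A = "tuples q"])
      (use x face_Suc_average_basis[OF that q] in auto)
  show ?thesis
    unfolding hoch_b_def sum.atMost_Suc_shift first h.sum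
    by (simp add: inner[unfolded CM_sel] h.scale sum_negf)
qed

lemma exact_at_even_column:
  assumes "even p" "0 < q"
  shows "exact_at p q"
  unfolding exact_at_def
proof (intro ballI impI)
  fix z assume z: "z \<in> obj CM q" and "q = 0 \<or> vert CM p q z = 0"
  then have "hoch_b CM q z = 0"
    using assms by (auto simp: vert_def)
  then have "vert CM p (Suc q) (average z) = z"
    using hoch_b_average[OF z assms(2)] assms(1) module_hom.zero[OF linear_average]
    by (simp add: vert_def)
  then show "\<exists>y \<in> obj CM (Suc q). vert CM p (Suc q) y = z"
    using average_in_obj[OF z] by blast
qed

text \<open>
  In degree \<open>0\<close> prepending \<open>e\<close> and applying \<open>b\<close> is multiplication by \<open>\<alpha>(e) - \<beta>(e)\<close>.
\<close>
lemma exact_at_even_column_0: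
  assumes "even p" "\<alpha> \<noteq> \<beta>"
  shows "exact_at p 0"
  unfolding exact_at_def
proof (intro ballI impI)
  fix z assume z: "z \<in> obj CM 0"
  have "lin_ext (CM_face G \<alpha> \<beta> 1 0) (average z) = z"
    by (rule linear_eq_on_basis[OF linear_o[OF linear_lin_ext linear_average] linear_pm_ident,
          where A = "tuples 0"])
      (use z face_0_average_basis[of 0] in auto)
  moreover have "lin_ext (CM_face G \<alpha> \<beta> 1 1) (average z) = (\<lambda>_. 0) z"
  proof (rule linear_eq_on_basis[OF linear_o[OF linear_lin_ext linear_average],
        where A = "tuples 0" and g = "\<lambda>_. 0"])
    show "module_hom pm_scale pm_scale (\<lambda>_. 0)"
      by unfold_locales auto
  qed (use z in \<open>auto simp: tuples_def lin_ext_average_basis CM_face_def sum_single_same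
    sum_weight_b[OF assms(2)]\<close>)
  ultimately have "vert CM p (Suc 0) (average z) = z"
    using assms(1) by (simp add: vert_def hoch_b_def)
  then show "\<exists>y \<in> obj CM (Suc 0). vert CM p (Suc 0) y = z"
    using average_in_obj[OF z] by blast
qed

lemma hoch_b_1_zero:
  assumes "\<alpha> = \<beta>" "v \<in> obj CM 1"
  shows "hoch_b CM 1 v = 0"
proof -
  have "lin_ext (CM_face G \<alpha> \<beta> 1 0) v = lin_ext (CM_face G \<alpha> \<beta> 1 1) v"
  proof (rule linear_eq_on_basis[OF linear_lin_ext linear_lin_ext, where A = "tuples 1"])
    fix gs assume "gs \<in> tuples 1"
    then obtain g where "gs = [g]"
      by (auto simp: tuples_def length_Suc_conv)
    then show "lin_ext (CM_face G \<alpha> \<beta> 1 0) (Poly_Mapping.single gs 1)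
        = lin_ext (CM_face G \<alpha> \<beta> 1 1) (Poly_Mapping.single gs 1)"
      using assms(1) by (simp add: CM_face_def)
  qed (use assms(2) in simp)
  then show ?thesis
    by (simp add: hoch_b_def)
qed

lemma HC_distinct_characters:
  assumes "\<alpha> \<noteq> \<beta>"
  shows "is_zero_module (HC G \<pi> \<alpha> \<beta> n)"
  unfolding HC_def
proof (rule cyclic_homology_zero)
  show "exact_at p (n - p)" for p
    using exact_at_odd_column exact_at_even_column exact_at_even_column_0 assms
    by (metis gr0I)
qed

lemma HC_odd:
  assumes "odd n"
  shows "is_zero_module (HC G \<pi> \<alpha> \<beta> n)"
  unfolding HC_def
proof (rule cyclic_homology_zero)
  fix p assume "p \<le> n"
  then have "odd p \<or> 0 < n - p"
    using assms by (metis le_neq_implies_less zero_less_diff)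
  then show "exact_at p (n - p)"
    using exact_at_odd_column exact_at_even_column by metis
qed

lemma HC_even:
  assumes "\<alpha> = \<beta>" "even n"
  shows "HC G \<pi> \<alpha> \<beta> n \<cong>\<^sub>M (base_module :: ('k, 'k) module)"
  unfolding HC_def
proof (rule cyclic_homology_one_dimensional[OF _ _ _ _ assms(2)])
  let ?\<epsilon> = "\<lambda>x. Poly_Mapping.lookup x []"
  show "exact_at p q" if "odd p \<or> q \<noteq> 0" for p q
    using that exact_at_odd_column exact_at_even_column by (metis gr0I)
  show "hoch_b CM 1 v = 0" if "v \<in> obj CM 1" for v
    using hoch_b_1_zero[OF assms(1) that] .
  show "module_hom (scl CM) (*) ?\<epsilon>"
    by unfold_locales (auto simp: lookup_add lookup_pm_scale algebra_simps)
  have "x = Poly_Mapping.single [] (?\<epsilon> x)" if "x \<in> obj CM 0" for x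
    using that
    by (intro poly_mapping_eqI) (auto simp: tuples_def lookup_single when_def in_keys_iff subset_iff)
  moreover have "Poly_Mapping.single [] c \<in> obj CM 0" for c
    by (simp add: tuples_def)
  ultimately show "bij_betw ?\<epsilon> (obj CM 0) UNIV"
    by (intro bij_betw_byWitness[where f' = "Poly_Mapping.single []"])
      (auto simp del: CM_sel)
qed

end

lemma (in group) cyclic_subgroup_index_pos:
  assumes "finite (carrier G)" "x \<in> carrier G"
  shows "cyclic_subgroup_index G x > 0"
proof -
  have "subgroup (generate G {x}) G"
    using assms by (intro generate_is_subgroup) auto
  then have "rcosets\<^bsub>G\<^esub> (generate G {x}) \<noteq> {}"
    using subgroup.subgroup_in_rcosets is_group by blast
  moreover have "finite (rcosets\<^bsub>G\<^esub> (generate G {x}))"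
    using assms by (simp add: RCOSETS_def)
  ultimately show ?thesis
    by (simp add: cyclic_subgroup_index_def card_gt_0_iff)
qed

theorem proposition3p13:
  fixes m :: nat and G :: "int monoid" and \<pi> :: int and m\<^sub>\<pi> :: nat
    and \<alpha> \<beta> :: "(int \<Rightarrow>\<^sub>0 'k::field_char_0) \<Rightarrow> 'k"
  assumes "m \<ge> 1"
    and "G = integer_mod_group m"
    and "\<alpha> \<in> characters G" and "\<beta> \<in> characters G"
    and "\<pi> \<in> carrier G"
    and "\<alpha> (grp_elt \<pi>) = 1" and "\<beta> (grp_elt \<pi>) = 1"
    and "m\<^sub>\<pi> = cyclic_subgroup_index G \<pi>"
  shows "(\<alpha> \<noteq> \<beta> \<longrightarrow> (\<forall>n. is_zero_module (HC G \<pi> \<alpha> \<beta> n))) \<and>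
    (\<forall>n. even n \<longrightarrow>
      HC G \<pi> \<alpha> \<alpha> n \<cong>\<^sub>M direct_sum_module base_module (power_module (Ann_module m\<^sub>\<pi>) (n div 2))) \<and>
    (\<forall>n. odd n \<longrightarrow>
      HC G \<pi> \<alpha> \<alpha> n \<cong>\<^sub>M power_module (quot_by_nat m\<^sub>\<pi>) ((n + 1) div 2))"
proof -
  interpret G: comm_group G
    using assms(2) by simp
  have finite: "finite (carrier G)"
    using assms(1,2) by (simp add: carrier_integer_mod_group)
  then have "order G > 0"
    by (simp add: G.order_gt_0_iff_finite)
  then have order: "of_nat (order G) \<noteq> (0 :: 'k)"
    by simp
  interpret \<alpha>\<beta>: twisted_finite_group_algebra G \<pi> \<alpha> \<beta>
    by unfold_locales (use assms finite order in auto)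
  interpret \<alpha>\<alpha>: twisted_finite_group_algebra G \<pi> \<alpha> \<alpha>
    by unfold_locales (use assms finite order in auto)
  have index: "of_nat m\<^sub>\<pi> \<noteq> (0 :: 'k)"
    using G.cyclic_subgroup_index_pos[OF finite assms(5)] assms(8) by simp
  show ?thesis
  proof (intro conjI impI allI)
    show "is_zero_module (HC G \<pi> \<alpha> \<beta> n)" if "\<alpha> \<noteq> \<beta>" for n
      using \<alpha>\<beta>.HC_distinct_characters[OF that] .
    show "HC G \<pi> \<alpha> \<alpha> n \<cong>\<^sub>M direct_sum_module base_module (power_module (Ann_module m\<^sub>\<pi>) (n div 2))"
      if "even n" for n
      using \<alpha>\<alpha>.HC_even[OF refl that] base_module_iso_direct_sum_Ann[OF index]
      by (rule module_iso_trans)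
    show "HC G \<pi> \<alpha> \<alpha> n \<cong>\<^sub>M power_module (quot_by_nat m\<^sub>\<pi>) ((n + 1) div 2)" if "odd n" for n
      using zero_module_iso_power_quot_by_nat[OF index \<alpha>\<alpha>.HC_odd[OF that]] .
  qed
qed

end
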